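(* If $n\ge2s$, then $\lim_{p\to\infty}c(p)=\lambda_1$.
   Context: Let $s\in(0,1)$ and let $\Omega\subset\mathbb R^n$ be a bounded domain with Lipschitz boundary. Let $K:\mathbb R^n\setminus\{0\}\to(0,\infty)$ satisfy: (i) $mK\in L^1(\mathbb R^n)$ with $m(x)=\min\{|x|^2,1\}$; (ii) there is $\lambda>0$ with $K(x)\ge\lambda|x|^{-(n+2s)}$ for all $x\ne0$; (iii) $K(x)=K(-x)$. Put $Q=\mathbb R^{2n}\setminus((\mathbb R^n\setminus\Omega)\times(\mathbb R^n\setminus\Omega))$. Let $X$ be the space of measurable $u:\mathbb R^n\to\mathbb R$ with $u|_\Omega\in L^2(\Omega)$ and $(u(x)-u(y))\sqrt{K(x-y)}\in L^2(Q)$, and let $X_0=\{u\in X: u=0 \text{ a.e. in }\mathbb R^n\setminus\Omega\}$, a Hilbert space with norm $\|u\|_{X_0}=\left(\int_Q|u(x)-u(y)|^2K(x-y)\,dx\,dy\right)^{1/2}$. Write $u^+=\max(u,0)$. $\lambda_1=\inf\{\|u\|_{X_0}^2: u\in X_0,\ \int_\Omega u^2=1\}$ is a simple eigenvalue, attained by functions of constant sign; $\phi_1$ denotes the nonnegative minimizer with $\int_\Omega\phi_1^2=1$. Let $\mathcal P=\{u\in X_0:\int_\Omega u^2\,dx=1\}$ with the topology of $X_0$, and for $p\ge0$ let $J_p(u)=\|u\|_{X_0}^2-p\int_\Omega(u^+)^2\,dx$, $\Gamma=\{\gamma\in C([-1,1],\mathcal P):\gamma(-1)=-\phi_1,\ \gamma(1)=\phi_1\}$,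 and $c(p)=\inf_{\gamma\in\Gamma}\max_{u\in\gamma([-1,1])}J_p(u)$. *)

theory Defs
  imports "HOL-Analysis.Analysis"
begin

text \<open>
  The space \<open>\<real>\<^sup>n\<close> is a Euclidean space \<open>'a\<close> with \<open>n = DIM('a)\<close>. Measurability and integrals refer
  to Lebesgue (not only Borel) measurable functions, both on \<open>'a\<close> and on \<open>'a \<times> 'a\<close>.
\<close>

text \<open>
  Near each boundary point the set is, in suitable orthonormal coordinates with last axis \<open>e\<close>,
  the region strictly above the graph of a Lipschitz function \<open>g\<close> defined on the hyperplane
  orthogonal to \<open>e\<close>.
\<close>
definition lipschitz_boundary :: "'a::euclidean_space set \<Rightarrow> bool" where
  "lipschitz_boundary \<Omega> \<longleftrightarrow>
     (\<forall>x\<in>frontier \<Omega>. \<exists>r>0. \<exists>e g L. norm e = 1 \<and> L-lipschitz_on {z. z \<bullet> e = 0} g \<and>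
        \<Omega> \<inter> ball x r = {y \<in> ball x r. y \<bullet> e > (g (y - (y \<bullet> e) *\<^sub>R e) :: real)})"

definition bounded_lipschitz_domain :: "'a::euclidean_space set \<Rightarrow> bool" where
  "bounded_lipschitz_domain \<Omega> \<longleftrightarrow>
     open \<Omega> \<and> connected \<Omega> \<and> \<Omega> \<noteq> {} \<and> bounded \<Omega> \<and> lipschitz_boundary \<Omega>"

text \<open>
  A kernel on \<open>\<real>\<^sup>n - {0}\<close> is a total function whose value at \<open>0\<close> is arbitrary; that value is
  always multiplied by \<open>0\<close> below.
\<close>
definition admissible_kernel :: "real \<Rightarrow> ('a::euclidean_space \<Rightarrow> real) \<Rightarrow> bool" where
  "admissible_kernel s K \<longleftrightarrow>
     (\<forall>x. x \<noteq> 0 \<longrightarrow> K x > 0) \<and>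
     integrable lebesgue (\<lambda>x. min ((norm x)\<^sup>2) 1 * K x) \<and>
     (\<exists>\<kappa>>0. \<forall>x. x \<noteq> 0 \<longrightarrow> K x \<ge> \<kappa> * norm x powr (- (real DIM('a) + 2 * s))) \<and>
     (\<forall>x. x \<noteq> 0 \<longrightarrow> K x = K (- x))"

definition L2_on :: "'a::euclidean_space set \<Rightarrow> ('a \<Rightarrow> real) \<Rightarrow> bool" where
  "L2_on A f \<longleftrightarrow> set_borel_measurable lebesgue A f \<and> set_integrable lebesgue A (\<lambda>x. (f x)\<^sup>2)"

definition Qset :: "'a::euclidean_space set \<Rightarrow> ('a \<times> 'a) set" where
  "Qset \<Omega> = UNIV - (UNIV - \<Omega>) \<times> (UNIV - \<Omega>)"

definition Xspace :: "'a::euclidean_space set \<Rightarrow> ('a \<Rightarrow> real) \<Rightarrow> ('a \<Rightarrow> real) set" where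
  "Xspace \<Omega> K = {u. u \<in> borel_measurable lebesgue \<and> L2_on \<Omega> u \<and>
     L2_on (Qset \<Omega>) (\<lambda>(x, y). (u x - u y) * sqrt (K (x - y)))}"

text \<open>
  Elements of \<open>X\<^sub>0\<close> are represented by functions, so that equality in \<open>X\<^sub>0\<close> is equality almost
  everywhere and \<open>X0_norm\<close> is a seminorm on representatives.
\<close>
definition X0 :: "'a::euclidean_space set \<Rightarrow> ('a \<Rightarrow> real) \<Rightarrow> ('a \<Rightarrow> real) set" where
  "X0 \<Omega> K = {u \<in> Xspace \<Omega> K. AE x in lebesgue. x \<notin> \<Omega> \<longrightarrow> u x = 0}"

definition X0_norm :: "'a::euclidean_space set \<Rightarrow> ('a \<Rightarrow> real) \<Rightarrow> ('a \<Rightarrow> real) \<Rightarrow> real" where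
  "X0_norm \<Omega> K u =
     sqrt (set_lebesgue_integral lebesgue (Qset \<Omega>) (\<lambda>(x, y). \<bar>u x - u y\<bar>\<^sup>2 * K (x - y)))"

definition unit_sphere :: "'a::euclidean_space set \<Rightarrow> ('a \<Rightarrow> real) \<Rightarrow> ('a \<Rightarrow> real) set" where
  "unit_sphere \<Omega> K = {u \<in> X0 \<Omega> K. set_lebesgue_integral lebesgue \<Omega> (\<lambda>x. (u x)\<^sup>2) = 1}"

definition lambda1 :: "'a::euclidean_space set \<Rightarrow> ('a \<Rightarrow> real) \<Rightarrow> real" where
  "lambda1 \<Omega> K = (INF u\<in>unit_sphere \<Omega> K. (X0_norm \<Omega> K u)\<^sup>2)"

definition nonneg_minimizer ::
    "'a::euclidean_space set \<Rightarrow> ('a \<Rightarrow> real) \<Rightarrow> ('a \<Rightarrow> real) \<Rightarrow> bool" where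
  "nonneg_minimizer \<Omega> K \<phi> \<longleftrightarrow>
     \<phi> \<in> unit_sphere \<Omega> K \<and> (X0_norm \<Omega> K \<phi>)\<^sup>2 = lambda1 \<Omega> K \<and> (AE x in lebesgue. \<phi> x \<ge> 0)"

definition J :: "'a::euclidean_space set \<Rightarrow> ('a \<Rightarrow> real) \<Rightarrow> real \<Rightarrow> ('a \<Rightarrow> real) \<Rightarrow> real" where
  "J \<Omega> K p u =
     (X0_norm \<Omega> K u)\<^sup>2 - p * set_lebesgue_integral lebesgue \<Omega> (\<lambda>x. (max (u x) 0)\<^sup>2)"

text \<open>
  Paths in the unit sphere, continuous for the topology induced by the seminorm of \<open>X\<^sub>0\<close>; the
  endpoint conditions are equalities in \<open>X\<^sub>0\<close>.
\<close>
definition paths ::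
    "'a::euclidean_space set \<Rightarrow> ('a \<Rightarrow> real) \<Rightarrow> ('a \<Rightarrow> real) \<Rightarrow> (real \<Rightarrow> 'a \<Rightarrow> real) set" where
  "paths \<Omega> K \<phi> = {\<gamma>.
     (\<forall>t\<in>{-1..1}. \<gamma> t \<in> unit_sphere \<Omega> K) \<and>
     (\<forall>t\<in>{-1..1}. ((\<lambda>\<tau>. X0_norm \<Omega> K (\<lambda>x. \<gamma> \<tau> x - \<gamma> t x)) \<longlongrightarrow> 0) (at t within {-1..1})) \<and>
     (AE x in lebesgue. \<gamma> (-1) x = - \<phi> x) \<and>
     (AE x in lebesgue. \<gamma> 1 x = \<phi> x)}"

text \<open>
  The supremum is a maximum: \<open>J \<Omega> K p\<close> is continuous along each path and \<open>{-1..1}\<close> is compact.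
\<close>
definition minimax_level ::
    "'a::euclidean_space set \<Rightarrow> ('a \<Rightarrow> real) \<Rightarrow> ('a \<Rightarrow> real) \<Rightarrow> real \<Rightarrow> real" where
  "minimax_level \<Omega> K \<phi> p = (INF \<gamma>\<in>paths \<Omega> K \<phi>. SUP u\<in>\<gamma> ` {-1..1}. J \<Omega> K p u)"

end

theory Submission
  imports Defs
begin

text \<open>
  Along every path the functional starts at \<open>\<lambda>\<^sub>1\<close>, because \<open>- \<phi>\<^sub>1\<close> has no positive part; so the minimax
  level is at least \<open>\<lambda>\<^sub>1\<close> (\<open>path_sup_ge_lambda1\<close>). For the converse it is enough to find a nonnegative
  \<open>\<psi>\<close> in \<open>X\<^sub>0\<close> that is not dominated by any multiple of \<open>\<phi>\<^sub>1\<close>. Indeed, on the normalised path through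
  \<open>t \<phi>\<^sub>1 + (1 - \<bar>t\<bar>) \<psi>\<close> the positive part vanishes only at \<open>t = -1\<close>; a large penalty \<open>p\<close> therefore brings
  the functional down except close to \<open>- \<phi>\<^sub>1\<close>, where the seminorm is close to \<open>\<lambda>\<^sub>1\<close> anyway
  (\<open>minimax_level_tendsto_lambda1\<close>).

  The existence of \<open>\<psi>\<close> is proved by contradiction, with no regularity theory for \<open>\<phi>\<^sub>1\<close>. Suppose that
  every nonnegative element of \<open>X\<^sub>0\<close> is dominated by a multiple of \<open>\<phi>\<^sub>1\<close>. A gliding hump argument makes
  the domination uniform in terms of energy and \<open>L\<^sup>2\<close> norm (\<open>uniform_domination\<close>). Tested on tents of radius \<open>r\<close>,
  whose energy is of order \<open>r\<^sup>n\<^sup>-\<^sup>2 M(r)\<close> with \<open>M(r) = \<integral> min(\<bar>z\<bar>\<^sup>2, r\<^sup>2) K(z) dz\<close>, domination yields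
  \<open>\<phi>\<^sub>1(x)\<^sup>2 \<ge> c r\<^sup>2\<^sup>-\<^sup>n / M(r)\<close> whenever the ball of radius \<open>2 r\<close> about \<open>x\<close> lies in \<open>\<Omega>\<close>
  (\<open>dominating_function_lower_bound\<close>).

  For \<open>n \<ge> 2\<close> this is absurd, as \<open>M(r)\<close> tends to 0 with \<open>r\<close> (\<open>no_pointwise_bound_dim_ge_2\<close>). For \<open>n = 1\<close>
  it says that \<open>\<phi>\<^sub>1\<^sup>2 \<ge> c d / M(d)\<close> at distance \<open>d\<close> from an end point of the interval \<open>\<Omega>\<close>. The energy of
  \<open>\<phi>\<^sub>1\<close> contains the interaction with the complement of \<open>\<Omega>\<close>, which is at least \<open>\<integral> \<phi>\<^sub>1\<^sup>2 \<kappa>(d)\<close> for the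
  tail \<open>\<kappa>\<close> of the kernel; since \<open>M' = 4 d \<kappa>\<close>, this integral is bounded below by a multiple of
  \<open>\<integral> M' / M\<close>, which diverges at \<open>d = 0\<close> (\<open>no_pointwise_bound_dim_1\<close>).
\<close>

section \<open>The seminorm as a quadratic form\<close>

lemma set_lebesgue_integral_nonneg:
  fixes f :: "'b \<Rightarrow> real"
  assumes "\<And>x. f x \<ge> 0" shows "0 \<le> set_lebesgue_integral M A f"
  unfolding set_lebesgue_integral_def using assms by (intro integral_nonneg_AE AE_I2) auto

lemma L2_on_iff:
  "L2_on A f \<longleftrightarrow> (\<lambda>x. indicator A x * f x) \<in> borel_measurable lebesgue \<and>
     integrable lebesgue (\<lambda>x. (indicator A x * f x)\<^sup>2)"
proof -
  have "(\<lambda>x. indicator A x *\<^sub>R (f x)\<^sup>2) = (\<lambda>x. (indicator A x * f x)\<^sup>2)"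
    by (auto simp: fun_eq_iff indicator_def)
  then show ?thesis
    by (simp add: L2_on_def set_borel_measurable_def set_integrable_def)
qed

text \<open>
  From \<open>2 \<bar>f g\<bar> \<le> f\<^sup>2 + g\<^sup>2\<close>.
\<close>
lemma L2_on_mult_set_integrable:
  assumes "L2_on A f" "L2_on A g"
  shows "set_integrable lebesgue A (\<lambda>x. f x * g x)"
proof -
  let ?f = "\<lambda>x. indicator A x * f x" and ?g = "\<lambda>x. indicator A x * g x"
  have [measurable]: "?f \<in> borel_measurable lebesgue" "?g \<in> borel_measurable lebesgue"
    and int: "integrable lebesgue (\<lambda>x. (?f x)\<^sup>2)" "integrable lebesgue (\<lambda>x. (?g x)\<^sup>2)"
    using assms by (auto simp: L2_on_iff)
  have "integrable lebesgue (\<lambda>x. ?f x * ?g x)"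
  proof (rule Bochner_Integration.integrable_bound[OF Bochner_Integration.integrable_add[OF int]])
    show "AE x in lebesgue. norm (?f x * ?g x) \<le> norm ((?f x)\<^sup>2 + (?g x)\<^sup>2)"
    proof (rule AE_I2)
      fix x
      have "2 * \<bar>?f x * ?g x\<bar> \<le> (?f x)\<^sup>2 + (?g x)\<^sup>2"
        using sum_squares_bound[of "\<bar>?f x\<bar>" "\<bar>?g x\<bar>"]
        unfolding power2_abs abs_mult[of "?f x" "?g x"] by (simp only: mult.assoc)
      moreover have "0 \<le> (?f x)\<^sup>2 + (?g x)\<^sup>2" by simp
      ultimately show "norm (?f x * ?g x) \<le> norm ((?f x)\<^sup>2 + (?g x)\<^sup>2)"
        by (simp only: real_norm_def abs_of_nonneg)
    qed
  qed measurable
  moreover have "(\<lambda>x. ?f x * ?g x) = (\<lambda>x. indicator A x *\<^sub>R (f x * g x))"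
    by (auto simp: fun_eq_iff indicator_def)
  ultimately show ?thesis by (simp add: set_integrable_def)
qed

lemma L2_on_lincomb:
  assumes "L2_on A f" "L2_on A g"
  shows "L2_on A (\<lambda>x. a * f x + b * g x)"
    and "(LINT x:A|lebesgue. (a * f x + b * g x)\<^sup>2) =
      a\<^sup>2 * (LINT x:A|lebesgue. (f x)\<^sup>2) + 2 * a * b * (LINT x:A|lebesgue. f x * g x)
      + b\<^sup>2 * (LINT x:A|lebesgue. (g x)\<^sup>2)"
proof -
  have f: "set_integrable lebesgue A (\<lambda>x. (f x)\<^sup>2)" and g: "set_integrable lebesgue A (\<lambda>x. (g x)\<^sup>2)"
    and [measurable]: "(\<lambda>x. indicator A x * f x) \<in> borel_measurable lebesgue"
      "(\<lambda>x. indicator A x * g x) \<in> borel_measurable lebesgue"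
    using assms unfolding L2_on_iff by (auto simp: L2_on_def assms(1)[unfolded L2_on_def] assms(2)[unfolded L2_on_def])
  note fg = L2_on_mult_set_integrable[OF assms]
  have expand: "(a * f x + b * g x)\<^sup>2 = a\<^sup>2 * (f x)\<^sup>2 + 2 * a * b * (f x * g x) + b\<^sup>2 * (g x)\<^sup>2" for x
    by (simp add: power2_eq_square algebra_simps)
  have i1: "set_integrable lebesgue A (\<lambda>x. a\<^sup>2 * (f x)\<^sup>2)"
    and i2: "set_integrable lebesgue A (\<lambda>x. 2 * a * b * (f x * g x))"
    and i3: "set_integrable lebesgue A (\<lambda>x. b\<^sup>2 * (g x)\<^sup>2)"
    using f g fg by auto
  have "set_integrable lebesgue A (\<lambda>x. (a * f x + b * g x)\<^sup>2)"
    unfolding expand using i1 i2 i3 by (intro set_integral_add)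
  moreover have "(\<lambda>x. a * (indicator A x * f x) + b * (indicator A x * g x)) \<in> borel_measurable lebesgue"
    by measurable
  then have "set_borel_measurable lebesgue A (\<lambda>x. a * f x + b * g x)"
    by (simp add: set_borel_measurable_def algebra_simps)
  ultimately show "L2_on A (\<lambda>x. a * f x + b * g x)" by (simp add: L2_on_def)
  show "(LINT x:A|lebesgue. (a * f x + b * g x)\<^sup>2) =
      a\<^sup>2 * (LINT x:A|lebesgue. (f x)\<^sup>2) + 2 * a * b * (LINT x:A|lebesgue. f x * g x)
      + b\<^sup>2 * (LINT x:A|lebesgue. (g x)\<^sup>2)"
    unfolding expand using i1 i2 i3
    by (simp add: set_integral_add)
qed

text \<open>
  The seminorm of \<open>X\<^sub>0\<close> is the \<open>L\<^sup>2\<close> norm of this function on \<open>Qset \<Omega>\<close>, and the function depends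
  linearly on \<open>u\<close>; this is what makes \<open>X\<^sub>0\<close> a space with a quadratic form.
\<close>
definition weighted_diff :: "('a::euclidean_space \<Rightarrow> real) \<Rightarrow> ('a \<Rightarrow> real) \<Rightarrow> 'a \<times> 'a \<Rightarrow> real" where
  "weighted_diff K u = (\<lambda>(x, y). (u x - u y) * sqrt (K (x - y)))"

lemma X0_iff:
  "u \<in> X0 \<Omega> K \<longleftrightarrow> u \<in> borel_measurable lebesgue \<and> L2_on \<Omega> u \<and>
     L2_on (Qset \<Omega>) (weighted_diff K u) \<and> (AE x in lebesgue. x \<notin> \<Omega> \<longrightarrow> u x = 0)"
  by (auto simp: X0_def Xspace_def weighted_diff_def)

text \<open>
  Taking the square root of the kernel is harmless at \<open>x = y\<close>, where \<open>K (x - y)\<close> may be negative,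
  because the difference of the values of \<open>u\<close> vanishes there.
\<close>
lemma X0_norm_eq:
  assumes "\<And>z. z \<noteq> 0 \<Longrightarrow> K z > 0"
  shows "X0_norm \<Omega> K u = sqrt (LINT z:Qset \<Omega>|lebesgue. (weighted_diff K u z)\<^sup>2)"
proof -
  have "\<bar>u x - u y\<bar>\<^sup>2 * K (x - y) = ((u x - u y) * sqrt (K (x - y)))\<^sup>2" for x y
    using assms[of "x - y"] by (cases "x = y") (auto simp: power_mult_distrib)
  then have "(\<lambda>(x, y). \<bar>u x - u y\<bar>\<^sup>2 * K (x - y)) = (\<lambda>z. (weighted_diff K u z)\<^sup>2)"
    by (auto simp: fun_eq_iff weighted_diff_def)
  then show ?thesis unfolding X0_norm_def by simp
qed

lemma X0_norm_nonneg: "(\<And>z. z \<noteq> 0 \<Longrightarrow> K z > 0) \<Longrightarrow> 0 \<le> X0_norm \<Omega> K u"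
  by (auto simp: X0_norm_eq intro!: set_lebesgue_integral_nonneg)

lemma X0_norm_sq:
  assumes "\<And>z. z \<noteq> 0 \<Longrightarrow> K z > 0"
  shows "(X0_norm \<Omega> K u)\<^sup>2 = (LINT z:Qset \<Omega>|lebesgue. (weighted_diff K u z)\<^sup>2)"
  using assms by (auto simp: X0_norm_eq intro!: set_lebesgue_integral_nonneg)

lemma weighted_diff_lincomb:
  "weighted_diff K (\<lambda>x. a * u x + b * v x) = (\<lambda>z. a * weighted_diff K u z + b * weighted_diff K v z)"
  by (auto simp: weighted_diff_def fun_eq_iff algebra_simps)

lemma X0_lincomb:
  assumes "u \<in> X0 \<Omega> K" "v \<in> X0 \<Omega> K"
  shows "(\<lambda>x. a * u x + b * v x) \<in> X0 \<Omega> K"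
proof -
  have "AE x in lebesgue. x \<notin> \<Omega> \<longrightarrow> u x = 0" "AE x in lebesgue. x \<notin> \<Omega> \<longrightarrow> v x = 0"
    using assms by (auto simp: X0_iff)
  then have "AE x in lebesgue. x \<notin> \<Omega> \<longrightarrow> a * u x + b * v x = 0"
    by eventually_elim auto
  then show ?thesis
    using assms by (auto simp: X0_iff weighted_diff_lincomb intro!: L2_on_lincomb)
qed

text \<open>
  Along a two-dimensional family the squared seminorm is a quadratic polynomial in the coordinates,
  so continuity of the paths built below is continuity of polynomials. The constant \<open>B\<close> is the
  inner product of \<open>u\<close> and \<open>v\<close>.
\<close>
lemma X0_norm_sq_lincomb:
  assumes pos: "\<And>z. z \<noteq> 0 \<Longrightarrow> K z > 0" and "u \<in> X0 \<Omega> K" "v \<in> X0 \<Omega> K"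
  obtains B where "\<And>a b. (X0_norm \<Omega> K (\<lambda>x. a * u x + b * v x))\<^sup>2 =
    a\<^sup>2 * (X0_norm \<Omega> K u)\<^sup>2 + 2 * a * b * B + b\<^sup>2 * (X0_norm \<Omega> K v)\<^sup>2"
proof
  fix a b
  show "(X0_norm \<Omega> K (\<lambda>x. a * u x + b * v x))\<^sup>2 =
    a\<^sup>2 * (X0_norm \<Omega> K u)\<^sup>2
    + 2 * a * b * (LINT z:Qset \<Omega>|lebesgue. weighted_diff K u z * weighted_diff K v z)
    + b\<^sup>2 * (X0_norm \<Omega> K v)\<^sup>2"
    using assms by (subst (1 2 3) X0_norm_sq[OF pos]) (auto simp: weighted_diff_lincomb X0_iff L2_on_lincomb(2))
qed

text \<open>
  This is \<open>\<parallel>u - 2v\<parallel>\<^sup>2 \<ge> 0\<close> rearranged. It replaces the triangle inequality for paths.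
\<close>
lemma X0_norm_sq_le_double:
  assumes pos: "\<And>z. z \<noteq> 0 \<Longrightarrow> K z > 0" and u: "u \<in> X0 \<Omega> K" and v: "v \<in> X0 \<Omega> K"
  shows "(X0_norm \<Omega> K u)\<^sup>2 \<le> 2 * (X0_norm \<Omega> K v)\<^sup>2 + 2 * (X0_norm \<Omega> K (\<lambda>x. u x - v x))\<^sup>2"
proof -
  obtain B where B: "\<And>a b. (X0_norm \<Omega> K (\<lambda>x. a * u x + b * v x))\<^sup>2 =
    a\<^sup>2 * (X0_norm \<Omega> K u)\<^sup>2 + 2 * a * b * B + b\<^sup>2 * (X0_norm \<Omega> K v)\<^sup>2"
    using X0_norm_sq_lincomb[OF pos u v] by blast
  have "0 \<le> (X0_norm \<Omega> K u)\<^sup>2 - 4 * B + 4 * (X0_norm \<Omega> K v)\<^sup>2"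
    using zero_le_power2[of "X0_norm \<Omega> K (\<lambda>x. 1 * u x + (-2) * v x)"] unfolding B by simp
  moreover have "(X0_norm \<Omega> K (\<lambda>x. u x - v x))\<^sup>2 = (X0_norm \<Omega> K u)\<^sup>2 - 2 * B + (X0_norm \<Omega> K v)\<^sup>2"
    using B[of 1 "-1"] by simp
  ultimately show ?thesis by simp
qed

section \<open>Lower bound along paths and the minimax level\<close>

lemma lambda1_le:
  assumes "u \<in> unit_sphere \<Omega> K"
  shows "lambda1 \<Omega> K \<le> (X0_norm \<Omega> K u)\<^sup>2"
  unfolding lambda1_def by (rule cINF_lower[OF _ assms]) (auto intro!: bdd_belowI[of _ 0])

lemma L2_on_pos_part:
  assumes "L2_on \<Omega> u"
  shows "L2_on \<Omega> (\<lambda>x. max (u x) 0)"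
proof -
  have [measurable]: "(\<lambda>x. indicator \<Omega> x * u x) \<in> borel_measurable lebesgue"
    and i: "integrable lebesgue (\<lambda>x. (indicator \<Omega> x * u x)\<^sup>2)" using assms by (auto simp: L2_on_iff)
  have eq: "(\<lambda>x. indicator \<Omega> x * max (u x) 0) = (\<lambda>x. max (indicator \<Omega> x * u x) 0)"
    by (auto simp: fun_eq_iff indicator_def)
  have "integrable lebesgue (\<lambda>x. (max (indicator \<Omega> x * u x) 0)\<^sup>2)"
    by (rule Bochner_Integration.integrable_bound[OF i]) (auto simp: max_def)
  then show ?thesis unfolding L2_on_iff fun_cong[OF eq] by auto
qed

lemma J_le_X0_norm_sq:
  assumes "p \<ge> 0" shows "J \<Omega> K p u \<le> (X0_norm \<Omega> K u)\<^sup>2"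
  using assms set_lebesgue_integral_nonneg[of "\<lambda>x. (max (u x) 0)\<^sup>2" lebesgue \<Omega>]
  by (simp add: J_def)

text \<open>
  The functional is at most the squared seminorm, which is bounded near every parameter by
  continuity of the path, hence bounded on the compact interval. Without an upper bound the supremum
  in the definition of the minimax level would be an arbitrary real number.
\<close>
lemma path_J_bdd_above:
  assumes pos: "\<And>z. z \<noteq> 0 \<Longrightarrow> K z > 0" and \<gamma>: "\<gamma> \<in> paths \<Omega> K \<phi>" and p: "p \<ge> 0"
  shows "bdd_above (J \<Omega> K p ` \<gamma> ` {-1..1})"
proof -
  let ?N = "\<lambda>u. (X0_norm \<Omega> K u)\<^sup>2"
  have X: "\<gamma> t \<in> X0 \<Omega> K" if "t \<in> {-1..1}" for t
    using \<gamma> that by (auto simp: paths_def unit_sphere_def)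
  have loc: "\<exists>d>0. \<forall>\<tau>\<in>{-1..1}. dist \<tau> t < d \<longrightarrow> ?N (\<gamma> \<tau>) \<le> 2 * ?N (\<gamma> t) + 2"
    if t: "t \<in> {-1..1}" for t
  proof -
    have "((\<lambda>\<tau>. X0_norm \<Omega> K (\<lambda>x. \<gamma> \<tau> x - \<gamma> t x)) \<longlongrightarrow> 0) (at t within {-1..1})"
      using \<gamma> t by (auto simp: paths_def)
    then have "eventually (\<lambda>\<tau>. dist (X0_norm \<Omega> K (\<lambda>x. \<gamma> \<tau> x - \<gamma> t x)) 0 < 1) (at t within {-1..1})"
      by (rule tendstoD) simp
    then obtain d where d: "d > 0"
      "\<And>\<tau>. \<tau> \<in> {-1..1} \<Longrightarrow> \<tau> \<noteq> t \<Longrightarrow> dist \<tau> t < d \<Longrightarrow> \<bar>X0_norm \<Omega> K (\<lambda>x. \<gamma> \<tau> x - \<gamma> t x)\<bar> < 1"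
      by (auto simp: eventually_at dist_real_def)
    have "?N (\<gamma> \<tau>) \<le> 2 * ?N (\<gamma> t) + 2" if \<tau>: "\<tau> \<in> {-1..1}" "dist \<tau> t < d" for \<tau>
    proof (cases "\<tau> = t")
      case False
      then have "?N (\<lambda>x. \<gamma> \<tau> x - \<gamma> t x) \<le> 1"
        using d(2)[of \<tau>] \<tau> by (simp add: abs_square_le_1)
      then show ?thesis using X0_norm_sq_le_double[OF pos X[OF \<tau>(1)] X[OF t]] by simp
    qed (use zero_le_power2[of "X0_norm \<Omega> K (\<gamma> t)"] in simp)
    then show ?thesis using d(1) by blast
  qed
  then obtain d where d: "\<And>t. t \<in> {-1..1} \<Longrightarrow> d t > 0"
    "\<And>t \<tau>. t \<in> {-1..1} \<Longrightarrow> \<tau> \<in> {-1..1} \<Longrightarrow> dist \<tau> t < d t \<Longrightarrow> ?N (\<gamma> \<tau>) \<le> 2 * ?N (\<gamma> t) + 2"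
    by metis
  have "{-1..1::real} \<subseteq> (\<Union>t\<in>{-1..1}. ball t (d t))" using d(1) by fastforce
  then obtain T where T: "T \<subseteq> {-1..1::real}" "finite T" "{-1..1} \<subseteq> (\<Union>t\<in>T. ball t (d t))"
    using compactE_image[of "{-1..1::real}" "{-1..1}" "\<lambda>t. ball t (d t)"] by auto
  have "J \<Omega> K p (\<gamma> \<tau>) \<le> (\<Sum>t\<in>T. 2 * ?N (\<gamma> t) + 2)" if \<tau>: "\<tau> \<in> {-1..1}" for \<tau>
  proof -
    obtain t where t: "t \<in> T" "dist \<tau> t < d t" using T(3) \<tau> by (auto simp: dist_commute)
    have "J \<Omega> K p (\<gamma> \<tau>) \<le> ?N (\<gamma> \<tau>)" by (rule J_le_X0_norm_sq[OF p])
    also have "\<dots> \<le> 2 * ?N (\<gamma> t) + 2" using d(2)[OF _ \<tau> t(2)] t(1) T(1) by blast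
    also have "\<dots> \<le> (\<Sum>t\<in>T. 2 * ?N (\<gamma> t) + 2)"
      by (rule member_le_sum[OF t(1) _ T(2)]) (simp add: add_nonneg_nonneg)
    finally show ?thesis .
  qed
  then show ?thesis by (intro bdd_aboveI[where M = "\<Sum>t\<in>T. 2 * ?N (\<gamma> t) + 2"]) auto
qed

text \<open>
  The starting point \<open>- \<phi>\<close> of a path has no positive part, so there the functional equals the squared
  seminorm.
\<close>
lemma path_sup_ge_lambda1:
  assumes pos: "\<And>z. z \<noteq> 0 \<Longrightarrow> K z > 0" and \<gamma>: "\<gamma> \<in> paths \<Omega> K \<phi>" and p: "p \<ge> 0"
    and nonneg: "AE x in lebesgue. \<phi> x \<ge> 0"
  shows "lambda1 \<Omega> K \<le> (SUP u\<in>\<gamma> ` {-1..1}. J \<Omega> K p u)"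
proof -
  have s: "\<gamma> (-1) \<in> unit_sphere \<Omega> K" and e: "AE x in lebesgue. \<gamma> (-1) x = - \<phi> x"
    using \<gamma> by (auto simp: paths_def)
  have "AE x in lebesgue. indicator \<Omega> x *\<^sub>R (max (\<gamma> (-1) x) 0)\<^sup>2 = (0::real)"
    using e nonneg by eventually_elim (auto simp: max_def)
  then have "set_lebesgue_integral lebesgue \<Omega> (\<lambda>x. (max (\<gamma> (-1) x) 0)\<^sup>2) = 0"
    unfolding set_lebesgue_integral_def by (rule integral_eq_zero_AE)
  then have "lambda1 \<Omega> K \<le> J \<Omega> K p (\<gamma> (-1))"
    using lambda1_le[OF s] by (simp add: J_def)
  also have "\<dots> \<le> (SUP u\<in>\<gamma> ` {-1..1}. J \<Omega> K p u)"
    by (rule cSUP_upper[OF _ path_J_bdd_above[OF pos \<gamma> p]]) auto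
  finally show ?thesis .
qed

text \<open>
  Lower bounds for the penalty term \<open>\<integral> (u\<^sup>+)\<^sup>2\<close> come from pointwise comparison.
\<close>
lemma L2_on_pos_part_le:
  assumes "L2_on \<Omega> u" "L2_on \<Omega> v" and c: "c \<ge> 0"
    and le: "AE x in lebesgue. c * max (v x) 0 \<le> max (u x) 0"
  shows "c\<^sup>2 * (LINT x:\<Omega>|lebesgue. (max (v x) 0)\<^sup>2) \<le> (LINT x:\<Omega>|lebesgue. (max (u x) 0)\<^sup>2)"
proof -
  have iu: "set_integrable lebesgue \<Omega> (\<lambda>x. (max (u x) 0)\<^sup>2)"
    and iv: "set_integrable lebesgue \<Omega> (\<lambda>x. (max (v x) 0)\<^sup>2)"
    using L2_on_pos_part[OF assms(1)] L2_on_pos_part[OF assms(2)] by (auto simp: L2_on_def)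
  have icv: "set_integrable lebesgue \<Omega> (\<lambda>x. c\<^sup>2 * (max (v x) 0)\<^sup>2)" using iv by simp
  have "(LINT x:\<Omega>|lebesgue. c\<^sup>2 * (max (v x) 0)\<^sup>2) \<le> (LINT x:\<Omega>|lebesgue. (max (u x) 0)\<^sup>2)"
    unfolding set_lebesgue_integral_def
  proof (rule integral_mono_AE)
    show "AE x in lebesgue. indicator \<Omega> x *\<^sub>R (c\<^sup>2 * (max (v x) 0)\<^sup>2)
        \<le> indicator \<Omega> x *\<^sub>R (max (u x) 0)\<^sup>2"
      using le
    proof eventually_elim
      case (elim x)
      have "(c * max (v x) 0)\<^sup>2 \<le> (max (u x) 0)\<^sup>2"
        using elim c by (intro power_mono) auto
      then show ?case by (auto simp: power_mult_distrib indicator_def)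
    qed
  qed (use iu icv in \<open>unfold set_integrable_def, simp_all\<close>)
  then show ?thesis by simp
qed

lemma pos_part_integral_le:
  assumes "L2_on \<Omega> u"
  shows "(LINT x:\<Omega>|lebesgue. (max (u x) 0)\<^sup>2) \<le> (LINT x:\<Omega>|lebesgue. (u x)\<^sup>2)"
  using L2_on_pos_part[OF assms] assms unfolding set_lebesgue_integral_def L2_on_def set_integrable_def
  by (intro integral_mono) (auto simp: indicator_def max_def)

lemma not_AE_le_pos_part:
  assumes \<Omega>: "\<Omega> \<in> sets lebesgue" and u: "L2_on \<Omega> u" and "u \<in> borel_measurable lebesgue"
    and nd: "\<not> (AE x in lebesgue. x \<in> \<Omega> \<longrightarrow> u x \<le> 0)"
  shows "(LINT x:\<Omega>|lebesgue. (max (u x) 0)\<^sup>2) > 0"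
proof (rule ccontr)
  let ?f = "\<lambda>x. indicator \<Omega> x *\<^sub>R (max (u x) 0)\<^sup>2"
  assume "\<not> ?thesis"
  moreover have "0 \<le> (LINT x:\<Omega>|lebesgue. (max (u x) 0)\<^sup>2)" by (rule set_lebesgue_integral_nonneg) simp
  ultimately have "integral\<^sup>L lebesgue ?f = 0" unfolding set_lebesgue_integral_def by linarith
  moreover have "integrable lebesgue ?f"
    using L2_on_pos_part[OF u] by (simp add: L2_on_def set_integrable_def)
  ultimately have "AE x in lebesgue. ?f x = 0"
    by (subst (asm) integral_nonneg_eq_0_iff_AE) auto
  then have "AE x in lebesgue. x \<in> \<Omega> \<longrightarrow> u x \<le> 0"
    by eventually_elim (auto simp: indicator_def max_def split: if_splits)
  with nd show False by simp
qed

text \<open>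
  The path is the normalisation of \<open>w t = t \<phi> + (1 - \<bar>t\<bar>) \<psi>\<close>. Near \<open>t = -1\<close> its squared seminorm is close
  to \<open>\<lambda>\<^sub>1\<close>. For \<open>t \<ge> -1 + \<delta>\<close> the positive part of \<open>w t\<close> is bounded below in \<open>L\<^sup>2\<close>: for negative \<open>t\<close> it
  dominates \<open>\<delta> (\<psi> - \<phi> / \<delta>)\<^sup>+\<close>, which is not zero because no multiple of \<open>\<phi>\<close> dominates \<open>\<psi>\<close>, and for
  positive \<open>t\<close> it is \<open>w t\<close> itself. On that part of the path the penalty \<open>p\<close> makes the functional small.
\<close>
lemma minimax_level_tendsto_lambda1:
  assumes pos: "\<And>z. z \<noteq> 0 \<Longrightarrow> K z > 0" and \<Omega>: "\<Omega> \<in> sets lebesgue"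
    and min: "nonneg_minimizer \<Omega> K \<phi>" and \<psi>: "\<psi> \<in> X0 \<Omega> K" "\<And>x. \<psi> x \<ge> 0"
    and nd: "\<And>r. \<not> (AE x in lebesgue. x \<in> \<Omega> \<longrightarrow> \<psi> x \<le> r * \<phi> x)"
  shows "((\<lambda>p. minimax_level \<Omega> K \<phi> p) \<longlongrightarrow> lambda1 \<Omega> K) at_top"
proof -
  let ?A = "\<lambda>u. LINT x:\<Omega>|lebesgue. (u x)\<^sup>2" and ?P = "\<lambda>u. LINT x:\<Omega>|lebesgue. (max (u x) 0)\<^sup>2"
  let ?N = "\<lambda>u. (X0_norm \<Omega> K u)\<^sup>2"
  have \<phi>: "\<phi> \<in> X0 \<Omega> K" "?A \<phi> = 1" "?N \<phi> = lambda1 \<Omega> K" "AE x in lebesgue. \<phi> x \<ge> 0"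
    using min by (auto simp: nonneg_minimizer_def unit_sphere_def)
  have L: "L2_on \<Omega> \<phi>" "L2_on \<Omega> \<psi>" using \<phi> \<psi> by (auto simp: X0_iff)
  note lin = X0_lincomb[OF \<phi>(1) \<psi>(1)]
  obtain B where B: "\<And>a b. ?N (\<lambda>x. a * \<phi> x + b * \<psi> x) = a\<^sup>2 * ?N \<phi> + 2 * a * b * B + b\<^sup>2 * ?N \<psi>"
    using X0_norm_sq_lincomb[OF pos \<phi>(1) \<psi>(1)] by blast
  define C where "C = (LINT x:\<Omega>|lebesgue. \<phi> x * \<psi> x)"
  have A: "?A (\<lambda>x. a * \<phi> x + b * \<psi> x) = a\<^sup>2 + 2 * a * b * C + b\<^sup>2 * ?A \<psi>" for a b
    unfolding C_def L2_on_lincomb(2)[OF L] \<phi>(2) by simp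
  have C0: "C \<ge> 0"
    unfolding C_def set_lebesgue_integral_def using \<phi>(4) \<psi>(2)
    by (intro integral_nonneg_AE) (auto elim!: eventually_mono)
  have P\<psi>: "?P (\<lambda>x. \<psi> x - r * \<phi> x) > 0" for r
  proof (rule not_AE_le_pos_part[OF \<Omega>])
    show "L2_on \<Omega> (\<lambda>x. \<psi> x - r * \<phi> x)" "(\<lambda>x. \<psi> x - r * \<phi> x) \<in> borel_measurable lebesgue"
      using lin[of "-r" 1] by (auto simp: X0_iff)
    show "\<not> (AE x in lebesgue. x \<in> \<Omega> \<longrightarrow> \<psi> x - r * \<phi> x \<le> 0)" using nd[of r] by simp
  qed
  have A\<psi>: "?A \<psi> > 0" using P\<psi>[of 0] pos_part_integral_le[OF L(2)] by simp
  define w where "w t = (\<lambda>x. t * \<phi> x + (1 - \<bar>t\<bar>) * \<psi> x)" for t :: real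
  \<comment> \<open>\<open>q t\<close> is the squared \<open>L\<^sup>2\<close> norm of \<open>w t\<close>.\<close>
  define q where "q t = t\<^sup>2 + 2 * t * (1 - \<bar>t\<bar>) * C + (1 - \<bar>t\<bar>)\<^sup>2 * ?A \<psi>" for t :: real
  have wq: "?A (w t) = q t" for t unfolding w_def A q_def by simp
  have wX: "w t \<in> X0 \<Omega> K" for t unfolding w_def by (rule lin)
  then have wL: "L2_on \<Omega> (w t)" for t by (auto simp: X0_iff)
  have Pq: "?P (w t) \<le> q t" for t using pos_part_integral_le[OF wL[of t]] wq[of t] by simp
  \<comment> \<open>Away from \<open>t = -1\<close> the positive part of \<open>w t\<close> does not degenerate.\<close>
  have Pneg: "\<delta>\<^sup>2 * ?P (\<lambda>x. \<psi> x - (1/\<delta>) * \<phi> x) \<le> ?P (w t)"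
    if \<delta>: "0 < \<delta>" and t: "-1 + \<delta> \<le> t" "t \<le> 0" for \<delta> t
  proof (rule L2_on_pos_part_le[OF wL])
    show "L2_on \<Omega> (\<lambda>x. \<psi> x - (1/\<delta>) * \<phi> x)" using lin[of "-(1/\<delta>)" 1] by (auto simp: X0_iff)
    show "AE x in lebesgue. \<delta> * max (\<psi> x - (1/\<delta>) * \<phi> x) 0 \<le> max (w t x) 0"
      using \<phi>(4)
    proof eventually_elim
      case (elim x)
      show ?case
      proof (cases "\<psi> x - (1/\<delta>) * \<phi> x \<le> 0")
        case False
        have "\<delta> * (\<psi> x - (1/\<delta>) * \<phi> x) \<le> (1 + t) * (\<psi> x - (1/\<delta>) * \<phi> x)"
          using False t by (intro mult_right_mono) auto
        also have "\<dots> \<le> w t x"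
        proof -
          have "- t \<le> 1" "1 \<le> (1 + t) / \<delta>" using t \<delta> by (auto simp: field_simps)
          then have "- t * \<phi> x \<le> ((1 + t) / \<delta>) * \<phi> x" using elim by (intro mult_right_mono) linarith+
          then show ?thesis using t by (simp add: w_def algebra_simps)
        qed
        finally show ?thesis using False by simp
      qed (use \<delta> in simp)
    qed
  qed (use \<delta> in simp)
  have Ppos: "?P (w t) = q t" if t: "0 \<le> t" "t \<le> 1" for t
  proof -
    have "AE x in lebesgue. w t x \<ge> 0" using \<phi>(4) by eventually_elim (use t \<psi>(2) in \<open>auto simp: w_def\<close>)
    then have "?P (w t) = ?A (w t)" unfolding set_lebesgue_integral_def
      using wX[of t] L2_on_pos_part[OF wL[of t]] wL[of t]
      by (intro integral_cong_AE) (auto simp: L2_on_def set_integrable_def elim!: eventually_mono)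
    then show ?thesis by (simp add: wq)
  qed
  have q0: "q t > 0" if t: "t \<in> {-1..1}" for t
  proof (cases "t = -1")
    case False
    show ?thesis
    proof (cases "t \<le> 0")
      case True
      have "0 < (1 + t)\<^sup>2 * ?P (\<lambda>x. \<psi> x - (1/(1+t)) * \<phi> x)"
        using P\<psi>[of "1/(1+t)"] t False by auto
      also have "\<dots> \<le> ?P (w t)" using Pneg[of "1+t" t] t False True by auto
      finally show ?thesis using Pq[of t] by simp
    next
      case False
      then show ?thesis using t C0 A\<psi>
        by (auto simp: q_def intro!: add_pos_nonneg mult_nonneg_nonneg)
    qed
  qed (simp add: q_def)
  have q1: "q (-1) = 1" "q 1 = 1" by (auto simp: q_def)
  define \<alpha> where "\<alpha> t = t / sqrt (q t)" for t
  define \<beta> where "\<beta> t = (1 - \<bar>t\<bar>) / sqrt (q t)" for t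
  define \<gamma> where "\<gamma> t = (\<lambda>x. \<alpha> t * \<phi> x + \<beta> t * \<psi> x)" for t
  have cq: "continuous_on {-1..1} q" unfolding q_def by (intro continuous_intros)
  have c\<alpha>: "continuous_on {-1..1} \<alpha>" and c\<beta>: "continuous_on {-1..1} \<beta>"
    unfolding \<alpha>_def \<beta>_def using q0 by (auto intro!: continuous_intros cq) force+
  have \<gamma>w: "\<gamma> t x = w t x / sqrt (q t)" for t x
    by (simp add: \<gamma>_def w_def \<alpha>_def \<beta>_def add_divide_distrib)
  have A\<gamma>: "?A (\<gamma> t) = 1" if t: "t \<in> {-1..1}" for t
    using q0[OF t] by (simp add: \<gamma>w power_divide wq)
  have P\<gamma>: "?P (\<gamma> t) = ?P (w t) / q t" if t: "t \<in> {-1..1}" for t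
  proof -
    have "(max (\<gamma> t x) 0)\<^sup>2 = (max (w t x) 0)\<^sup>2 / q t" for x
      using q0[OF t] by (auto simp: \<gamma>w max_def power_divide divide_le_0_iff)
    then show ?thesis by simp
  qed
  \<comment> \<open>\<open>e t\<close> is the squared seminorm of \<open>\<gamma> t\<close>.\<close>
  define e where "e t = (\<alpha> t)\<^sup>2 * ?N \<phi> + 2 * \<alpha> t * \<beta> t * B + (\<beta> t)\<^sup>2 * ?N \<psi>" for t
  have N\<gamma>: "?N (\<gamma> t) = e t" for t by (simp add: \<gamma>_def B e_def)
  have ce: "continuous_on {-1..1} e" unfolding e_def by (intro continuous_intros c\<alpha> c\<beta>)
  have e1: "e (-1) = lambda1 \<Omega> K" by (simp add: e_def \<alpha>_def \<beta>_def q1 \<phi>)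
  have \<gamma>: "\<gamma> \<in> paths \<Omega> K \<phi>"
    unfolding paths_def
  proof (intro CollectI conjI ballI)
    fix t :: real assume t: "t \<in> {-1..1}"
    show "\<gamma> t \<in> unit_sphere \<Omega> K"
      unfolding unit_sphere_def using A\<gamma>[OF t] lin by (auto simp: \<gamma>_def)
    have eq: "X0_norm \<Omega> K (\<lambda>x. \<gamma> \<tau> x - \<gamma> t x) = sqrt ((\<alpha> \<tau> - \<alpha> t)\<^sup>2 * ?N \<phi>
        + 2 * (\<alpha> \<tau> - \<alpha> t) * (\<beta> \<tau> - \<beta> t) * B + (\<beta> \<tau> - \<beta> t)\<^sup>2 * ?N \<psi>)" for \<tau>
    proof -
      have "(\<lambda>x. \<gamma> \<tau> x - \<gamma> t x) = (\<lambda>x. (\<alpha> \<tau> - \<alpha> t) * \<phi> x + (\<beta> \<tau> - \<beta> t) * \<psi> x)"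
        by (auto simp: \<gamma>_def fun_eq_iff algebra_simps)
      moreover have "X0_norm \<Omega> K u \<ge> 0" for u
        by (rule X0_norm_nonneg[OF pos])
      ultimately show ?thesis
        unfolding B[of "\<alpha> \<tau> - \<alpha> t" "\<beta> \<tau> - \<beta> t", symmetric] by (simp only: real_sqrt_abs abs_of_nonneg)
    qed
    have "(\<alpha> \<longlongrightarrow> \<alpha> t) (at t within {-1..1})" "(\<beta> \<longlongrightarrow> \<beta> t) (at t within {-1..1})"
      using c\<alpha> c\<beta> t by (auto simp: continuous_on_def)
    then have "((\<lambda>\<tau>. X0_norm \<Omega> K (\<lambda>x. \<gamma> \<tau> x - \<gamma> t x)) \<longlongrightarrow> sqrt ((\<alpha> t - \<alpha> t)\<^sup>2 * ?N \<phi>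
        + 2 * (\<alpha> t - \<alpha> t) * (\<beta> t - \<beta> t) * B + (\<beta> t - \<beta> t)\<^sup>2 * ?N \<psi>)) (at t within {-1..1})"
      unfolding eq by (intro tendsto_intros)
    then show "((\<lambda>\<tau>. X0_norm \<Omega> K (\<lambda>x. \<gamma> \<tau> x - \<gamma> t x)) \<longlongrightarrow> 0) (at t within {-1..1})" by simp
  qed (auto simp: \<gamma>_def \<alpha>_def \<beta>_def q1)
  have lower: "lambda1 \<Omega> K \<le> minimax_level \<Omega> K \<phi> p" if p: "p \<ge> 0" for p
    unfolding minimax_level_def
    by (rule cINF_greatest) (use \<gamma> path_sup_ge_lambda1[OF pos _ p \<phi>(4)] in auto)
  have upper: "\<exists>p0\<ge>0. \<forall>p\<ge>p0. minimax_level \<Omega> K \<phi> p \<le> lambda1 \<Omega> K + \<epsilon>" if \<epsilon>: "\<epsilon> > 0" for \<epsilon>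
  proof -
    obtain \<delta>' where \<delta>': "\<delta>' > 0"
      "\<And>t. t \<in> {-1..1} \<Longrightarrow> dist t (-1) < \<delta>' \<Longrightarrow> dist (e t) (e (-1)) < \<epsilon>"
      using ce[unfolded continuous_on_iff, rule_format, of "-1" \<epsilon>] \<epsilon> by auto
    define \<delta> where "\<delta> = min (\<delta>'/2) 1"
    have \<delta>: "\<delta> > 0" "\<delta> \<le> 1" "\<delta> < \<delta>'" using \<delta>'(1) by (auto simp: \<delta>_def)
    have small: "e t \<le> lambda1 \<Omega> K + \<epsilon>" if "-1 \<le> t" "t \<le> -1 + \<delta>" for t
      using \<delta>'(2)[of t] that \<delta> e1 by (auto simp: dist_real_def)
    obtain M where M: "\<And>t. t \<in> {-1..1} \<Longrightarrow> e t \<le> M"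
      using compact_continuous_image[OF ce compact_Icc] compact_imp_bounded bounded_imp_bdd_above
      by (metis bdd_above.unfold image_eqI)
    obtain m where m: "\<And>t. t \<in> {-1..1} \<Longrightarrow> q t \<le> m"
      using compact_continuous_image[OF cq compact_Icc] compact_imp_bounded bounded_imp_bdd_above
      by (metis bdd_above.unfold image_eqI)
    have m1: "m \<ge> 1" using m[of 1] q1 by simp
    define d where "d = \<delta>\<^sup>2 * ?P (\<lambda>x. \<psi> x - (1/\<delta>) * \<phi> x)"
    have d0: "d > 0" unfolding d_def using P\<psi>[of "1/\<delta>"] \<delta> by simp
    \<comment> \<open>The bound 1 is for nonnegative \<open>t\<close>, where the positive part carries the whole \<open>L\<^sup>2\<close> norm.\<close>
    define c where "c = min (d / m) 1"
    have c0: "c > 0" using d0 m1 by (simp add: c_def)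
    have big: "?P (\<gamma> t) \<ge> c" if t: "-1 + \<delta> \<le> t" "t \<le> 1" for t
    proof (cases "t \<le> 0")
      case True
      have tt: "t \<in> {-1..1}" using t \<delta> by auto
      have "c \<le> d / m" by (simp add: c_def)
      also have "\<dots> \<le> d / q t" using m[OF tt] q0[OF tt] d0 by (intro divide_left_mono) auto
      also have "\<dots> \<le> ?P (w t) / q t" using Pneg[OF \<delta>(1) t(1) True] q0[OF tt]
        by (intro divide_right_mono) (auto simp: d_def)
      finally show ?thesis using P\<gamma>[OF tt] by simp
    next
      case False
      then have tt: "t \<in> {-1..1}" using t by auto
      show ?thesis using P\<gamma>[OF tt] Ppos[of t] False t q0[OF tt] by (simp add: c_def)
    qed
    define p0 where "p0 = max 0 ((M - lambda1 \<Omega> K) / c)"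
    have "minimax_level \<Omega> K \<phi> p \<le> lambda1 \<Omega> K + \<epsilon>" if p: "p \<ge> p0" for p
    proof -
      have p0: "p \<ge> 0" "M - p * c \<le> lambda1 \<Omega> K"
        using p c0 by (auto simp: p0_def pos_divide_le_eq)
      have Jle: "J \<Omega> K p (\<gamma> t) \<le> lambda1 \<Omega> K + \<epsilon>" if t: "t \<in> {-1..1}" for t
      proof (cases "t \<le> -1 + \<delta>")
        case True
        then show ?thesis using J_le_X0_norm_sq[OF p0(1), of \<Omega> K "\<gamma> t"] small[of t] t N\<gamma>[of t] by simp
      next
        case False
        then have "p * c \<le> p * ?P (\<gamma> t)" using big[of t] t p0(1) by (intro mult_left_mono) auto
        then show ?thesis using M[OF t] p0(2) N\<gamma>[of t] \<epsilon> by (simp add: J_def)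
      qed
      have "minimax_level \<Omega> K \<phi> p \<le> (SUP u\<in>\<gamma> ` {-1..1}. J \<Omega> K p u)"
        unfolding minimax_level_def
        by (rule cINF_lower[OF _ \<gamma>])
          (use path_sup_ge_lambda1[OF pos _ p0(1) \<phi>(4)] in \<open>auto intro!: bdd_belowI[of _ "lambda1 \<Omega> K"]\<close>)
      also have "\<dots> \<le> lambda1 \<Omega> K + \<epsilon>"
        by (rule cSUP_least) (use Jle in auto)
      finally show ?thesis .
    qed
    then show ?thesis by (intro exI[of _ p0]) (auto simp: p0_def)
  qed
  show ?thesis
  proof (rule tendstoI)
    fix \<epsilon> :: real assume "\<epsilon> > 0"
    then obtain p0 where p0: "p0 \<ge> 0" "\<And>p. p \<ge> p0 \<Longrightarrow> minimax_level \<Omega> K \<phi> p \<le> lambda1 \<Omega> K + \<epsilon>/2"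
      using upper[of "\<epsilon>/2"] by auto
    show "\<forall>\<^sub>F p in at_top. dist (minimax_level \<Omega> K \<phi> p) (lambda1 \<Omega> K) < \<epsilon>"
      using eventually_ge_at_top[of p0]
      by eventually_elim (use p0 lower \<open>\<epsilon> > 0\<close> in \<open>force simp: dist_real_def\<close>)
  qed
qed

section \<open>Borel kernels and Borel representatives\<close>

lemma lborel_distr_reflect: "distr lborel borel (\<lambda>y. c - y) = (lborel :: 'a::euclidean_space measure)"
  using lborel_affine[of "-1" c] by (simp add: density_1)

lemma nn_integral_lborel_reflect:
  fixes g :: "'a::euclidean_space \<Rightarrow> ennreal"
  assumes [measurable]: "g \<in> borel_measurable borel"
  shows "(\<integral>\<^sup>+y. g (c - y) \<partial>lborel) = (\<integral>\<^sup>+y. g y \<partial>lborel)"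
  by (subst (2) lborel_distr_reflect[of c, symmetric]) (simp add: nn_integral_distr)

lemma nn_integral_lborel_translate:
  fixes g :: "'a::euclidean_space \<Rightarrow> ennreal"
  assumes [measurable]: "g \<in> borel_measurable borel"
  shows "(\<integral>\<^sup>+y. g (y - c) \<partial>lborel) = (\<integral>\<^sup>+y. g y \<partial>lborel)"
  by (subst (2) lborel_distr_plus[of "-c", symmetric]) (simp add: nn_integral_distr)

text \<open>
  Null sets pull back to null sets along maps whose sections preserve null sets (Fubini).
\<close>
lemma AE_lborel_prod_section:
  fixes h :: "'a::euclidean_space \<times> 'a \<Rightarrow> 'a"
  assumes P: "AE x in lborel. P x" and [measurable]: "h \<in> borel_measurable borel"
    and null: "\<And>N. N \<in> null_sets lborel \<Longrightarrow> AE x in lborel. AE y in lborel. h (x, y) \<notin> N"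
  shows "AE z in lborel. P (h z)"
proof -
  obtain N where N: "N \<in> null_sets lborel" "{x. \<not> P x} \<subseteq> N"
    using P unfolding eventually_ae_filter by auto
  have [measurable]: "N \<in> sets borel" using N(1) by auto
  have "AE z in lborel \<Otimes>\<^sub>M lborel. h z \<notin> N"
  proof (rule lborel_pair.AE_pair_measure)
    have "{z. h z \<notin> N} \<in> sets borel" by measurable
    then show "{z \<in> space (lborel \<Otimes>\<^sub>M lborel). h z \<notin> N} \<in> sets (lborel \<Otimes>\<^sub>M lborel)"
      unfolding lborel_prod by simp
  qed (rule null[OF N(1)])
  then have "AE z in lborel. h z \<notin> N" unfolding lborel_prod .
  then show ?thesis by eventually_elim (use N(2) in auto)
qed

lemma AE_lborel_fst:
  fixes P :: "'a::euclidean_space \<Rightarrow> bool"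
  assumes "AE x in lborel. P x" shows "AE z in lborel. P (fst (z :: 'a \<times> 'a))"
  by (rule AE_lborel_prod_section[OF assms]) (auto simp: borel_prod[symmetric] dest: AE_not_in)

lemma AE_lborel_snd:
  fixes P :: "'a::euclidean_space \<Rightarrow> bool"
  assumes "AE x in lborel. P x" shows "AE z in lborel. P (snd (z :: 'a \<times> 'a))"
  by (rule AE_lborel_prod_section[OF assms]) (auto simp: borel_prod[symmetric] dest: AE_not_in)

lemma AE_lborel_reflect:
  fixes P :: "'a::euclidean_space \<Rightarrow> bool"
  assumes "AE x in lborel. P x" shows "AE x in lborel. P (c - x)"
proof -
  have "AE x in distr lborel borel (\<lambda>y. c - y). P x" using assms unfolding lborel_distr_reflect .
  then show ?thesis by (rule AE_distrD[rotated]) simp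
qed

lemma AE_lborel_diff:
  fixes P :: "'a::euclidean_space \<Rightarrow> bool"
  assumes "AE x in lborel. P x" shows "AE z in lborel. P (fst (z :: 'a \<times> 'a) - snd z)"
  by (rule AE_lborel_prod_section[OF assms])
    (auto simp: borel_prod[symmetric] intro!: AE_I2 AE_lborel_reflect AE_not_in)

lemma borel_measurable_lebesgue_cong_AE:
  fixes f g :: "'b::euclidean_space \<Rightarrow> real"
  assumes ae: "AE x in lborel. f x = g x" and g: "g \<in> borel_measurable borel"
  shows "f \<in> borel_measurable lebesgue"
proof (rule measurableI)
  fix A :: "real set" assume A: "A \<in> sets borel"
  have "AE x in lebesgue. x \<in> g -` A \<longleftrightarrow> x \<in> f -` A"
    using AE_completion[OF ae] by eventually_elim auto
  moreover have "g -` A \<in> sets lebesgue"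
    using measurable_sets[OF g A] by (simp add: sets_completionI_sets)
  ultimately show "f -` A \<inter> space lebesgue \<in> sets lebesgue"
    using completion.in_sets_AE[of "g -` A" "f -` A" lborel] by simp
qed simp

lemma integrable_lebesgue_cong_AE:
  fixes f g :: "'b::euclidean_space \<Rightarrow> real"
  assumes ae: "AE x in lborel. f x = g x" and g: "g \<in> borel_measurable borel" and "integrable lborel g"
  shows "integrable lebesgue f"
proof -
  have "integrable lebesgue g" using assms by (simp add: integrable_completion)
  then show ?thesis
    using AE_completion[OF ae] borel_measurable_lebesgue_cong_AE[OF ae g]
    by (subst integrable_cong_AE[where g = g]) auto
qed

text \<open>
  A kernel in \<open>admissible_kernel\<close> is only Lebesgue measurable. Fubini arguments are carried out for a
  Borel kernel \<open>k\<close> that agrees with it almost everywhere and is even everywhere.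
\<close>
locale symmetric_kernel =
  fixes k :: "'a::euclidean_space \<Rightarrow> real"
  assumes k_borel [measurable]: "k \<in> borel_measurable borel"
    and k_nonneg [simp]: "\<And>z. k z \<ge> 0"
    and k_even: "\<And>z. k (- z) = k z"
    and k_pos: "AE z in lborel. k z > 0"
    and k_integrable: "integrable lborel (\<lambda>z. min ((norm z)\<^sup>2) 1 * k z)"
begin

text \<open>
  Up to a constant, \<open>moment r / r\<^sup>2\<close> bounds the energy per unit volume of a bump at scale \<open>r\<close>. In dimension 1
  the derivative of the moment is, up to a factor \<open>r\<close>, the mass of the kernel beyond distance \<open>r\<close>, which
  is what links the energy of bumps to the interaction across the boundary.
\<close>
definition moment :: "real \<Rightarrow> real" where
  "moment r = (LINT z|lborel. min ((norm z)\<^sup>2) (r\<^sup>2) * k z)"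

definition energy :: "('a \<Rightarrow> real) \<Rightarrow> ennreal" where
  "energy u = (\<integral>\<^sup>+z. ennreal ((u (fst z) - u (snd z))\<^sup>2 * k (fst z - snd z)) \<partial>lborel)"

lemma moment_integrable: "integrable lborel (\<lambda>z. min ((norm z)\<^sup>2) (r\<^sup>2) * k z)"
proof (rule Bochner_Integration.integrable_bound[OF integrable_mult_right[OF k_integrable, of "max 1 (r\<^sup>2)"]])
  show "AE z in lborel. norm (min ((norm z)\<^sup>2) (r\<^sup>2) * k z)
      \<le> norm (max 1 (r\<^sup>2) * (min ((norm z)\<^sup>2) 1 * k z))"
  proof (rule AE_I2)
    fix z :: 'a
    have "min ((norm z)\<^sup>2) (r\<^sup>2) \<le> max 1 (r\<^sup>2) * min ((norm z)\<^sup>2) 1"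
    proof (cases "(norm z)\<^sup>2 \<le> 1")
      case True
      then have "1 * (norm z)\<^sup>2 \<le> max 1 (r\<^sup>2) * (norm z)\<^sup>2" by (intro mult_right_mono) auto
      then show ?thesis using True by simp
    qed simp
    then have "min ((norm z)\<^sup>2) (r\<^sup>2) * k z \<le> max 1 (r\<^sup>2) * min ((norm z)\<^sup>2) 1 * k z"
      by (rule mult_right_mono) simp
    then show "norm (min ((norm z)\<^sup>2) (r\<^sup>2) * k z) \<le> norm (max 1 (r\<^sup>2) * (min ((norm z)\<^sup>2) 1 * k z))"
      by (simp add: mult.assoc abs_mult)
  qed
qed measurable

lemma nn_integral_moment: "(\<integral>\<^sup>+z. ennreal (min ((norm z)\<^sup>2) (r\<^sup>2) * k z) \<partial>lborel) = ennreal (moment r)"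
  unfolding moment_def by (rule nn_integral_eq_integral[OF moment_integrable]) simp

lemma moment_mono: "0 \<le> r \<Longrightarrow> r \<le> r' \<Longrightarrow> moment r \<le> moment r'"
  unfolding moment_def
  by (intro integral_mono moment_integrable mult_right_mono min.mono power_mono) auto

text \<open>
  The \<open>L\<^sup>2\<close> norm of a bump is therefore controlled by its energy bound, up to the factor \<open>1 / moment 1\<close>.
\<close>
lemma moment_ge_sq:
  assumes "0 \<le> r" "r \<le> 1" shows "r\<^sup>2 * moment 1 \<le> moment r"
proof -
  have "(LINT z|lborel. r\<^sup>2 * (min ((norm z)\<^sup>2) (1\<^sup>2) * k z)) \<le> (LINT z|lborel. min ((norm z)\<^sup>2) (r\<^sup>2) * k z)"
  proof (intro integral_mono integrable_mult_right moment_integrable)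
    fix z :: 'a
    have r2: "r\<^sup>2 \<le> 1" using assms by (simp add: power_le_one)
    have "r\<^sup>2 * min ((norm z)\<^sup>2) (1\<^sup>2) \<le> min ((norm z)\<^sup>2) (r\<^sup>2)"
      using r2 mult_right_mono[OF r2, of "(norm z)\<^sup>2"] mult_left_mono[of "min ((norm z)\<^sup>2) 1" 1 "r\<^sup>2"]
        mult_left_mono[of "min ((norm z)\<^sup>2) 1" "(norm z)\<^sup>2" "r\<^sup>2"] by simp
    from mult_right_mono[OF this k_nonneg[of z]]
    show "r\<^sup>2 * (min ((norm z)\<^sup>2) (1\<^sup>2) * k z) \<le> min ((norm z)\<^sup>2) (r\<^sup>2) * k z"
      by (simp add: mult.assoc)
  qed
  then show ?thesis by (simp add: moment_def)
qed

lemma moment_pos: assumes "r > 0" shows "moment r > 0"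
proof (rule ccontr)
  assume "\<not> ?thesis"
  then have "ennreal (moment r) = 0" by (simp add: ennreal_neg)
  then have "AE z in lborel. min ((norm z)\<^sup>2) (r\<^sup>2) * k z \<le> 0"
    by (subst (asm) nn_integral_moment[symmetric], subst (asm) nn_integral_0_iff_AE) auto
  moreover have "AE z in lborel. (z::'a) \<noteq> 0" by (rule AE_lborel_singleton)
  ultimately have "AE z in (lborel :: 'a measure). False"
    using k_pos
  proof eventually_elim
    case (elim z)
    then have "0 < min ((norm z)\<^sup>2) (r\<^sup>2) * k z" using assms by (intro mult_pos_pos) auto
    with elim show False by linarith
  qed
  then have "ae_filter (lborel :: 'a measure) = bot" by (simp only: eventually_False)
  then show False by (simp add: ae_filter_eq_bot_iff)
qed

lemma moment_tendsto_0: "(\<lambda>i. moment (1 / real (Suc i))) \<longlonglongrightarrow> 0"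
proof -
  have "(\<lambda>i. LINT z|lborel. min ((norm z)\<^sup>2) ((1 / real (Suc i))\<^sup>2) * k z) \<longlonglongrightarrow> (LINT z|(lborel::'a measure). 0)"
  proof (rule integral_dominated_convergence[OF _ _ moment_integrable[of 1]])
    show "AE z in lborel. (\<lambda>i. min ((norm z)\<^sup>2) ((1 / real (Suc i))\<^sup>2) * k z) \<longlonglongrightarrow> 0"
    proof (rule AE_I2)
      fix z :: 'a
      have "(\<lambda>i. min ((norm z)\<^sup>2) ((1 / real (Suc i))\<^sup>2) * k z) \<longlonglongrightarrow> min ((norm z)\<^sup>2) (0\<^sup>2) * k z"
        using LIMSEQ_Suc[OF lim_1_over_n] by (intro tendsto_intros) auto
      then show "(\<lambda>i. min ((norm z)\<^sup>2) ((1 / real (Suc i))\<^sup>2) * k z) \<longlonglongrightarrow> 0" by simp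
    qed
    show "AE z in lborel. norm (min ((norm z)\<^sup>2) ((1 / real (Suc i))\<^sup>2) * k z) \<le> min ((norm z)\<^sup>2) (1\<^sup>2) * k z" for i
    proof (rule AE_I2)
      fix z :: 'a
      have "(1 / real (Suc i))\<^sup>2 \<le> 1\<^sup>2" by (intro power_mono) auto
      then have "min ((norm z)\<^sup>2) ((1 / real (Suc i))\<^sup>2) * k z \<le> min ((norm z)\<^sup>2) (1\<^sup>2) * k z"
        by (intro mult_right_mono min.mono) auto
      then show "norm (min ((norm z)\<^sup>2) ((1 / real (Suc i))\<^sup>2) * k z) \<le> min ((norm z)\<^sup>2) (1\<^sup>2) * k z"
        by (simp add: abs_mult)
    qed
  qed measurable
  then show ?thesis by (simp add: moment_def)
qed

text \<open>
  For functions that vanish everywhere outside \<open>\<Omega>\<close>, the energy over the whole product space equals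
  the energy over \<open>Qset \<Omega>\<close>.
\<close>
lemma X0I:
  assumes K: "AE z in lborel. K z = k z" and \<Omega>: "open \<Omega>" and [measurable]: "u \<in> borel_measurable borel"
    and 0: "\<And>x. x \<notin> \<Omega> \<Longrightarrow> u x = 0" and u2: "(\<integral>\<^sup>+x. ennreal ((u x)\<^sup>2) \<partial>lborel) < \<infinity>" and e: "energy u < \<infinity>"
  shows "u \<in> X0 \<Omega> K"
proof -
  have eq: "(\<lambda>x. indicator \<Omega> x * u x) = u" using 0 by (auto simp: fun_eq_iff indicator_def)
  have "integrable lborel (\<lambda>x. (u x)\<^sup>2)" by (rule integrableI_bounded) (use u2 in auto)
  then have L: "L2_on \<Omega> u" unfolding L2_on_iff fun_cong[OF eq]
    by (simp add: integrable_completion measurable_completion)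
  define G where "G = (\<lambda>z. (u (fst z) - u (snd z)) * sqrt (k (fst z - snd z)))"
  have [measurable]: "G \<in> borel_measurable borel" unfolding G_def by (simp add: borel_prod[symmetric])
  have G2: "(G z)\<^sup>2 = (u (fst z) - u (snd z))\<^sup>2 * k (fst z - snd z)" for z
    by (simp add: G_def power_mult_distrib)
  have "integrable lborel (\<lambda>z. (G z)\<^sup>2)"
  proof (rule integrableI_bounded)
    show "(\<integral>\<^sup>+z. ennreal (norm ((G z)\<^sup>2)) \<partial>lborel) < \<infinity>" using e by (simp add: G2 energy_def)
  qed measurable
  moreover have "AE z in lborel. indicator (Qset \<Omega>) z * weighted_diff K u z = G z"
    using AE_lborel_diff[OF K]
    by eventually_elim (auto simp: G_def weighted_diff_def Qset_def indicator_def 0 split: prod.splits)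
  ultimately have "L2_on (Qset \<Omega>) (weighted_diff K u)"
    unfolding L2_on_iff
    by (auto intro!: borel_measurable_lebesgue_cong_AE[where g = G]
      integrable_lebesgue_cong_AE[where g = "\<lambda>z. (G z)\<^sup>2"] elim!: eventually_mono)
  then show ?thesis using L 0 unfolding X0_iff by (auto simp: measurable_completion)
qed

lemma X0_borel_version:
  assumes K: "AE z in lborel. K z = k z" and \<Omega>: "open \<Omega>" and u: "u \<in> X0 \<Omega> K"
    and nonneg: "AE x in lebesgue. u x \<ge> 0"
  obtains f where "f \<in> borel_measurable borel" "AE x in lborel. u x = f x" "\<And>x. f x \<ge> 0"
    "\<And>x. x \<notin> \<Omega> \<Longrightarrow> f x = 0" "energy f < \<infinity>"
proof -
  have "u \<in> borel_measurable lebesgue" and Q: "L2_on (Qset \<Omega>) (weighted_diff K u)"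
    and 0: "AE x in lborel. x \<notin> \<Omega> \<longrightarrow> u x = 0"
    using u by (auto simp: X0_iff AE_completion_iff)
  then obtain g where g: "g \<in> borel_measurable lborel" "AE x in lborel. u x = g x"
    using completion_ex_borel_measurable_real by blast
  define f where "f x = indicator \<Omega> x * max (g x) 0" for x
  have f[measurable]: "f \<in> borel_measurable borel"
    unfolding f_def using g(1) \<Omega> by (auto intro!: borel_measurable_times borel_measurable_indicator)
  have nn: "AE x in lborel. u x \<ge> 0" using nonneg by (simp add: AE_completion_iff)
  have uf: "AE x in lborel. u x = f x"
    using 0 g(2) nn by eventually_elim (auto simp: f_def indicator_def)
  have "AE z in lborel. (indicator (Qset \<Omega>) z * weighted_diff K u z)\<^sup>2
      = (f (fst z) - f (snd z))\<^sup>2 * k (fst z - snd z)"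
    using AE_lborel_diff[OF K] AE_lborel_fst[OF uf] AE_lborel_snd[OF uf]
    by eventually_elim (auto simp: weighted_diff_def Qset_def indicator_def f_def power_mult_distrib
        split: prod.splits)
  then have "energy f = (\<integral>\<^sup>+z. ennreal ((indicator (Qset \<Omega>) z * weighted_diff K u z)\<^sup>2) \<partial>lborel)"
    unfolding energy_def by (intro nn_integral_cong_AE) auto
  also have "\<dots> = (\<integral>\<^sup>+z. ennreal (norm ((indicator (Qset \<Omega>) z * weighted_diff K u z)\<^sup>2)) \<partial>lebesgue)"
    by (simp add: nn_integral_completion)
  also have "\<dots> < \<infinity>" using Q unfolding L2_on_iff integrable_iff_bounded by auto
  finally have "energy f < \<infinity>" .
  then show thesis by (intro that[of f] f uf) (auto simp: f_def)
qed

end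

text \<open>
  The Borel version is taken of the integrable function \<open>min (norm x)\<^sup>2 1 * K x\<close>, since that is the function known
  to be measurable, and then averaged with its reflection.
\<close>
lemma admissible_kernel_imp_symmetric_kernel:
  fixes K :: "'a::euclidean_space \<Rightarrow> real"
  assumes "admissible_kernel s K"
  obtains k where "symmetric_kernel k" "AE z in lborel. K z = k z"
proof -
  have pos: "K z > 0" and even: "K z = K (- z)" if "z \<noteq> 0" for z
    using assms that unfolding admissible_kernel_def by blast+
  have int: "integrable lebesgue (\<lambda>x. min ((norm x)\<^sup>2) 1 * K x)"
    using assms unfolding admissible_kernel_def by blast
  obtain g where [measurable]: "g \<in> borel_measurable borel"
    and g: "AE x in lborel. min ((norm x)\<^sup>2) 1 * K x = g x"
    using completion_ex_borel_measurable_real[OF borel_measurable_integrable[OF int]] by auto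
  define h where "h x = \<bar>g x\<bar> / min ((norm x)\<^sup>2) 1" for x
  define k where "k x = (h x + h (- x)) / 2" for x
  have [measurable]: "h \<in> borel_measurable borel" unfolding h_def by measurable
  have nz: "AE z in lborel. (z::'a) \<noteq> 0" by (rule AE_lborel_singleton)
  have Kh: "AE x in lborel. K x = h x"
    using g nz
  proof eventually_elim
    case (elim x)
    then have "min ((norm x)\<^sup>2) 1 > 0" by simp
    moreover have "\<bar>g x\<bar> = min ((norm x)\<^sup>2) 1 * K x"
      using elim pos[of x] calculation by (simp add: abs_mult flip: elim(1))
    ultimately show ?case unfolding h_def by (metis less_irrefl nonzero_mult_div_cancel_left)
  qed
  have Kk: "AE x in lborel. K x = k x"
    using Kh AE_lborel_reflect[OF Kh, of 0] nz
  proof eventually_elim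
    case (elim x)
    then show ?case using even[of x] by (simp add: k_def)
  qed
  have [measurable]: "k \<in> borel_measurable borel" unfolding k_def by measurable
  have "symmetric_kernel k"
  proof
    show "k \<in> borel_measurable borel" by measurable
    show "k z \<ge> 0" for z by (auto simp: k_def h_def intro!: add_nonneg_nonneg divide_nonneg_nonneg)
    show "k (- z) = k z" for z by (simp add: k_def)
    show "AE z in lborel. k z > 0" using Kk nz by eventually_elim (use pos in force)
    have "integrable lebesgue (\<lambda>x. min ((norm x)\<^sup>2) 1 * k x)"
      using Kk by (intro integrable_cong_AE_imp[OF int])
        (auto simp: AE_completion_iff intro!: measurable_completion)
    then show "integrable lborel (\<lambda>x. min ((norm x)\<^sup>2) 1 * k x)"
      by (subst (asm) integrable_completion) auto
  qed
  then show thesis using that Kk by blast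
qed

section \<open>Uniform domination and its test functions\<close>

lemma term_le_suminf_ennreal: "h i \<le> (\<Sum>i. h i)" for h :: "nat \<Rightarrow> ennreal"
proof -
  have "sum h {i} \<le> (\<Sum>i. h i)" by (rule sum_le_suminf) auto
  then show ?thesis by simp
qed

text \<open>
  If the sum is \<open>\<sigma> < \<infinity>\<close>, then all \<open>\<bar>f i - g i\<bar>\<close> are at most \<open>sqrt \<sigma>\<close>, hence so is the difference of the
  suprema; in particular they are both finite or both infinite. In the latter case \<open>enn2real\<close> sends
  both to 0, so that the inequality needs no exceptional null set.
\<close>
lemma enn2real_SUP_diff_sq_le:
  fixes f g :: "nat \<Rightarrow> real"
  assumes f: "\<And>i. f i \<ge> 0" and g: "\<And>i. g i \<ge> 0"
  shows "ennreal ((enn2real (SUP i. ennreal (f i)) - enn2real (SUP i. ennreal (g i)))\<^sup>2)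
    \<le> (\<Sum>i. ennreal ((f i - g i)\<^sup>2))"
proof (cases "\<Sum>i. ennreal ((f i - g i)\<^sup>2)")
  case (real \<sigma>)
  let ?F = "SUP i. ennreal (f i)" and ?G = "SUP i. ennreal (g i)"
  have d: "\<bar>f i - g i\<bar> \<le> sqrt \<sigma>" for i
  proof -
    have "ennreal ((f i - g i)\<^sup>2) \<le> (\<Sum>i. ennreal ((f i - g i)\<^sup>2))"
      by (rule term_le_suminf_ennreal)
    then have "(f i - g i)\<^sup>2 \<le> \<sigma>" using real by simp
    then show ?thesis using real_sqrt_le_mono[of "(f i - g i)\<^sup>2" \<sigma>] by simp
  qed
  have s0: "0 \<le> sqrt \<sigma>" using real by simp
  have up: "(SUP i. ennreal (a i)) \<le> (SUP i. ennreal (b i)) + ennreal (sqrt \<sigma>)"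
    if "\<And>i. a i \<le> b i + sqrt \<sigma>" "\<And>i. b i \<ge> 0" for a b :: "nat \<Rightarrow> real"
  proof (rule SUP_least)
    fix i
    have "ennreal (a i) \<le> ennreal (b i) + ennreal (sqrt \<sigma>)"
      using that[of i] s0 by (simp add: ennreal_leI flip: ennreal_plus)
    also have "\<dots> \<le> (SUP i. ennreal (b i)) + ennreal (sqrt \<sigma>)"
      by (intro add_right_mono SUP_upper) simp
    finally show "ennreal (a i) \<le> (SUP i. ennreal (b i)) + ennreal (sqrt \<sigma>)" .
  qed
  have FG: "?F \<le> ?G + ennreal (sqrt \<sigma>)" "?G \<le> ?F + ennreal (sqrt \<sigma>)"
  proof -
    have "f i \<le> g i + sqrt \<sigma>" "g i \<le> f i + sqrt \<sigma>" for i using d[of i] by linarith+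
    then show "?F \<le> ?G + ennreal (sqrt \<sigma>)" "?G \<le> ?F + ennreal (sqrt \<sigma>)"
      by (auto intro: up f g)
  qed
  have top: "G = top" if "F \<le> G + ennreal (sqrt \<sigma>)" "F = top" for F G :: ennreal
    using that by (auto simp: top_unique ennreal_add_eq_top)
  have "ennreal ((enn2real F - enn2real G)\<^sup>2) \<le> ennreal \<sigma>"
    if FG: "F \<le> G + ennreal (sqrt \<sigma>)" "G \<le> F + ennreal (sqrt \<sigma>)" for F G
  proof (cases "F = top \<or> G = top")
    case True
    then have "F = top" "G = top" using top FG by blast+
    then show ?thesis by simp
  next
    case False
    then obtain a b where ab: "F = ennreal a" "G = ennreal b" "a \<ge> 0" "b \<ge> 0"
      by (metis ennreal_cases)
    have "a \<le> b + sqrt \<sigma>" "b \<le> a + sqrt \<sigma>"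
      using FG s0 ab unfolding ab by (simp_all flip: ennreal_plus)
    then have "\<bar>a - b\<bar> \<le> sqrt \<sigma>" by linarith
    then have "(a - b)\<^sup>2 \<le> \<sigma>" using real by (metis real_sqrt_abs real_sqrt_le_iff)
    then show ?thesis using ab by (simp add: ennreal_leI)
  qed
  from this[OF FG] show ?thesis using real by simp
qed simp

context symmetric_kernel
begin

lemma energy_scale: "energy (\<lambda>x. b * u x) = ennreal (b\<^sup>2) * energy u"
  if [measurable]: "u \<in> borel_measurable borel"
proof -
  have [measurable]: "(\<lambda>z. (u (fst z) - u (snd z))\<^sup>2 * k (fst z - snd z)) \<in> borel_measurable borel"
    by (simp add: borel_prod[symmetric])
  have "(b * u x - b * u y)\<^sup>2 * c = b\<^sup>2 * ((u x - u y)\<^sup>2 * c)" for x y c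
    by (simp add: power2_eq_square algebra_simps)
  then have "energy (\<lambda>x. b * u x) =
      (\<integral>\<^sup>+z. ennreal (b\<^sup>2) * ennreal ((u (fst z) - u (snd z))\<^sup>2 * k (fst z - snd z)) \<partial>lborel)"
    unfolding energy_def by (simp only: ennreal_mult[symmetric] zero_le_power2 k_nonneg mult_nonneg_nonneg)
  also have "\<dots> = ennreal (b\<^sup>2) * energy u"
    unfolding energy_def by (rule nn_integral_cmult) measurable
  finally show ?thesis .
qed

text \<open>
  A uniform boundedness principle for order domination, by a gliding hump. If the constant cannot be
  uniform, choose functions \<open>\<eta> (\<iota> n)\<close> that violate it with constant \<open>4 ^ n\<close>, scale them so that their
  energies and squared \<open>L\<^sup>2\<close> norms are at most \<open>2 ^ -n\<close>, and take the pointwise supremum. Energy is countably subadditive under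
  suprema, so the supremum is in \<open>X\<^sub>0\<close>; being above each scaled \<open>\<eta> (\<iota> n)\<close> it is dominated by no multiple
  of \<open>\<phi>\<close>. Suprema rather than sums avoid completeness of \<open>X\<^sub>0\<close> and Minkowski's inequality.
\<close>
lemma uniform_domination:
  fixes \<eta> :: "'i \<Rightarrow> 'a \<Rightarrow> real" and c :: "'i \<Rightarrow> real"
  assumes K: "AE z in lborel. K z = k z" and \<Omega>: "open \<Omega>"
    and meas: "\<And>i. i \<in> I \<Longrightarrow> \<eta> i \<in> borel_measurable borel"
    and nonneg: "\<And>i x. i \<in> I \<Longrightarrow> \<eta> i x \<ge> 0"
    and zero: "\<And>i x. i \<in> I \<Longrightarrow> x \<notin> \<Omega> \<Longrightarrow> \<eta> i x = 0"
    and c: "\<And>i. i \<in> I \<Longrightarrow> c i > 0"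
    and bound: "\<And>i. i \<in> I \<Longrightarrow> (\<integral>\<^sup>+x. ennreal ((\<eta> i x)\<^sup>2) \<partial>lborel) \<le> ennreal (c i)"
      "\<And>i. i \<in> I \<Longrightarrow> energy (\<eta> i) \<le> ennreal (c i)"
    and dom: "\<And>\<psi>. \<psi> \<in> X0 \<Omega> K \<Longrightarrow> (\<And>x. \<psi> x \<ge> 0) \<Longrightarrow>
      \<exists>R. AE x in lborel. x \<in> \<Omega> \<longrightarrow> \<psi> x \<le> R * \<phi> x"
  shows "\<exists>C>0. \<forall>i\<in>I. AE x in lborel. x \<in> \<Omega> \<longrightarrow> (\<eta> i x)\<^sup>2 \<le> C * c i * (\<phi> x)\<^sup>2"
proof (rule ccontr)
  assume neg: "\<not> ?thesis"
  have "\<forall>n::nat. \<exists>i\<in>I. \<not> (AE x in lborel. x \<in> \<Omega> \<longrightarrow> (\<eta> i x)\<^sup>2 \<le> 4 ^ n * c i * (\<phi> x)\<^sup>2)"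
  proof (intro allI, rule ccontr)
    fix n :: nat
    assume "\<not> (\<exists>i\<in>I. \<not> (AE x in lborel. x \<in> \<Omega> \<longrightarrow> (\<eta> i x)\<^sup>2 \<le> 4 ^ n * c i * (\<phi> x)\<^sup>2))"
    then have "\<forall>i\<in>I. AE x in lborel. x \<in> \<Omega> \<longrightarrow> (\<eta> i x)\<^sup>2 \<le> 4 ^ n * c i * (\<phi> x)\<^sup>2" by blast
    then show False using neg by (auto dest!: spec[of _ "4 ^ n"])
  qed
  then have "\<exists>\<iota>. \<forall>n. \<iota> n \<in> I
      \<and> \<not> (AE x in lborel. x \<in> \<Omega> \<longrightarrow> (\<eta> (\<iota> n) x)\<^sup>2 \<le> 4 ^ n * c (\<iota> n) * (\<phi> x)\<^sup>2)"
    by (intro choice) blast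
  then obtain \<iota> where \<iota>: "\<And>n::nat. \<iota> n \<in> I"
    and bad: "\<And>n. \<not> (AE x in lborel. x \<in> \<Omega> \<longrightarrow> (\<eta> (\<iota> n) x)\<^sup>2 \<le> 4 ^ n * c (\<iota> n) * (\<phi> x)\<^sup>2)"
    by blast
  \<comment> \<open>The weights make the squared norms of \<open>b n * \<eta> (\<iota> n)\<close> summable.\<close>
  define b where "b n = sqrt ((1/2) ^ n / c (\<iota> n))" for n
  have b0: "b n \<ge> 0" and b2: "(b n)\<^sup>2 * c (\<iota> n) = (1/2) ^ n" for n
    using c[OF \<iota>[of n]] by (auto simp: b_def)
  define f where "f n x = b n * \<eta> (\<iota> n) x" for n x
  have [measurable]: "\<eta> (\<iota> n) \<in> borel_measurable borel" for n by (rule meas[OF \<iota>])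
  have f_meas [measurable]: "f n \<in> borel_measurable borel" for n unfolding f_def by measurable
  have f0: "f n x \<ge> 0" for n x unfolding f_def using b0 nonneg[OF \<iota>] by simp
  have sum2: "(\<Sum>n. ennreal ((1/2) ^ n)) < \<infinity>"
  proof -
    have "(\<Sum>n. ennreal ((1/2) ^ n)) = ennreal (\<Sum>n. (1/2) ^ n)"
      by (rule suminf_ennreal2) (auto intro!: summable_geometric)
    then show ?thesis by (simp only: ennreal_less_top infinity_ennreal_def)
  qed
  have f_L2: "(\<integral>\<^sup>+x. ennreal ((f n x)\<^sup>2) \<partial>lborel) \<le> ennreal ((1/2) ^ n)" for n
  proof -
    have "(\<integral>\<^sup>+x. ennreal ((f n x)\<^sup>2) \<partial>lborel) = ennreal ((b n)\<^sup>2) * (\<integral>\<^sup>+x. ennreal ((\<eta> (\<iota> n) x)\<^sup>2) \<partial>lborel)"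
      unfolding f_def power_mult_distrib by (simp add: ennreal_mult nn_integral_cmult)
    also have "\<dots> \<le> ennreal ((b n)\<^sup>2) * ennreal (c (\<iota> n))" by (intro mult_left_mono bound \<iota>) simp
    finally show ?thesis using c[OF \<iota>[of n]] by (simp add: b2 flip: ennreal_mult)
  qed
  have f_energy: "energy (f n) \<le> ennreal ((1/2) ^ n)" for n
  proof -
    have "energy (f n) = ennreal ((b n)\<^sup>2) * energy (\<eta> (\<iota> n))"
      unfolding f_def by (rule energy_scale) measurable
    also have "\<dots> \<le> ennreal ((b n)\<^sup>2) * ennreal (c (\<iota> n))" by (intro mult_left_mono bound \<iota>) simp
    finally show ?thesis using c[OF \<iota>[of n]] by (simp add: b2 flip: ennreal_mult)
  qed
  define \<psi> where "\<psi> x = enn2real (SUP n. ennreal (f n x))" for x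
  have [measurable]: "\<psi> \<in> borel_measurable borel" unfolding \<psi>_def by measurable
  have \<psi>0: "\<psi> x \<ge> 0" for x by (simp add: \<psi>_def)
  have \<psi>_sq: "ennreal ((\<psi> x)\<^sup>2) \<le> (\<Sum>n. ennreal ((f n x)\<^sup>2))" for x
    using enn2real_SUP_diff_sq_le[of "\<lambda>n. f n x" "\<lambda>_. 0", OF f0]
    by (simp only: \<psi>_def ennreal_0 SUP_const[OF UNIV_not_empty] enn2real_0 diff_zero order_refl)
  have L2_sum: "(\<integral>\<^sup>+x. (\<Sum>n. ennreal ((f n x)\<^sup>2)) \<partial>lborel) < \<infinity>"
  proof -
    have "(\<integral>\<^sup>+x. (\<Sum>n. ennreal ((f n x)\<^sup>2)) \<partial>lborel) = (\<Sum>n. \<integral>\<^sup>+x. ennreal ((f n x)\<^sup>2) \<partial>lborel)"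
      by (rule nn_integral_suminf) measurable
    also have "\<dots> \<le> (\<Sum>n. ennreal ((1/2) ^ n))" by (intro suminf_le f_L2) auto
    finally show ?thesis using sum2 by (rule le_less_trans)
  qed
  have "\<psi> \<in> X0 \<Omega> K"
  proof (rule X0I[OF K \<Omega>])
    show "\<psi> x = 0" if "x \<notin> \<Omega>" for x using zero[OF \<iota> that] by (simp add: \<psi>_def f_def)
    show "(\<integral>\<^sup>+x. ennreal ((\<psi> x)\<^sup>2) \<partial>lborel) < \<infinity>"
      using nn_integral_mono[OF \<psi>_sq] L2_sum by (rule le_less_trans)
    have "energy \<psi> \<le> (\<integral>\<^sup>+z. (\<Sum>n. ennreal ((f n (fst z) - f n (snd z))\<^sup>2 * k (fst z - snd z))) \<partial>lborel)"
      unfolding energy_def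
    proof (rule nn_integral_mono)
      fix z :: "'a \<times> 'a"
      have "ennreal ((\<psi> (fst z) - \<psi> (snd z))\<^sup>2) * ennreal (k (fst z - snd z))
          \<le> (\<Sum>n. ennreal ((f n (fst z) - f n (snd z))\<^sup>2)) * ennreal (k (fst z - snd z))"
        unfolding \<psi>_def by (intro mult_right_mono enn2real_SUP_diff_sq_le f0) simp
      then show "ennreal ((\<psi> (fst z) - \<psi> (snd z))\<^sup>2 * k (fst z - snd z))
          \<le> (\<Sum>n. ennreal ((f n (fst z) - f n (snd z))\<^sup>2 * k (fst z - snd z)))"
        by (simp add: ennreal_mult)
    qed
    also have "\<dots> = (\<Sum>n. energy (f n))"
      unfolding energy_def by (rule nn_integral_suminf) (simp add: borel_prod[symmetric])
    also have "\<dots> \<le> (\<Sum>n. ennreal ((1/2) ^ n))" by (intro suminf_le f_energy) auto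
    finally show "energy \<psi> < \<infinity>" using sum2 by (rule le_less_trans)
  qed measurable
  then obtain R where R: "AE x in lborel. x \<in> \<Omega> \<longrightarrow> \<psi> x \<le> R * \<phi> x" using dom \<psi>0 by blast
  have fin: "AE x in lborel. (\<Sum>n. ennreal ((f n x)\<^sup>2)) \<noteq> \<infinity>"
    using L2_sum by (intro nn_integral_PInf_AE) auto
  have f_le: "AE x in lborel. \<forall>n. f n x \<le> \<psi> x"
    using fin
  proof (eventually_elim, intro allI)
    fix x n assume x: "(\<Sum>n. ennreal ((f n x)\<^sup>2)) \<noteq> \<infinity>"
    then obtain \<sigma> where \<sigma>: "(\<Sum>n. ennreal ((f n x)\<^sup>2)) = ennreal \<sigma>" "\<sigma> \<ge> 0"
      by (metis ennreal_cases infinity_ennreal_def)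
    have "f m x \<le> sqrt \<sigma>" for m
    proof -
      have "ennreal ((f m x)\<^sup>2) \<le> (\<Sum>n. ennreal ((f n x)\<^sup>2))"
        by (rule term_le_suminf_ennreal)
      then show ?thesis using \<sigma> by (simp add: real_le_rsqrt)
    qed
    then have "(SUP n. ennreal (f n x)) \<le> ennreal (sqrt \<sigma>)" by (intro SUP_least ennreal_leI)
    then have "(SUP n. ennreal (f n x)) < top" using le_less_trans by fastforce
    then have "ennreal (\<psi> x) = (SUP n. ennreal (f n x))" by (simp add: \<psi>_def)
    moreover have "ennreal (f n x) \<le> (SUP n. ennreal (f n x))" by (rule SUP_upper) simp
    ultimately have "ennreal (f n x) \<le> ennreal (\<psi> x)" by simp
    then show "f n x \<le> \<psi> x" using \<psi>0 by simp
  qed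
  obtain n where "R\<^sup>2 < 2 ^ n" using real_arch_pow[of 2 "R\<^sup>2"] by auto
  then have n: "R\<^sup>2 \<le> 2 ^ n" by simp
  have "AE x in lborel. x \<in> \<Omega> \<longrightarrow> (\<eta> (\<iota> n) x)\<^sup>2 \<le> 4 ^ n * c (\<iota> n) * (\<phi> x)\<^sup>2"
    using R f_le
  proof (eventually_elim, intro impI)
    fix x assume "x \<in> \<Omega> \<longrightarrow> \<psi> x \<le> R * \<phi> x" "\<forall>n. f n x \<le> \<psi> x" "x \<in> \<Omega>"
    then have "f n x \<le> R * \<phi> x" by (meson order_trans)
    then have "(f n x)\<^sup>2 \<le> (R * \<phi> x)\<^sup>2" using f0 by (intro power_mono)
    also have "\<dots> \<le> 2 ^ n * (\<phi> x)\<^sup>2" using n by (simp add: power_mult_distrib mult_right_mono)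
    finally have "(b n)\<^sup>2 * (\<eta> (\<iota> n) x)\<^sup>2 \<le> 2 ^ n * (\<phi> x)\<^sup>2" by (simp add: f_def power_mult_distrib)
    then have "(2 ^ n * c (\<iota> n)) * ((b n)\<^sup>2 * (\<eta> (\<iota> n) x)\<^sup>2) \<le> (2 ^ n * c (\<iota> n)) * (2 ^ n * (\<phi> x)\<^sup>2)"
      using c[OF \<iota>[of n]] by (intro mult_left_mono) auto
    moreover have "(2 ^ n * c (\<iota> n)) * ((b n)\<^sup>2 * (\<eta> (\<iota> n) x)\<^sup>2) = (\<eta> (\<iota> n) x)\<^sup>2"
    proof -
      have "(2 ^ n * c (\<iota> n)) * ((b n)\<^sup>2 * (\<eta> (\<iota> n) x)\<^sup>2) = 2 ^ n * ((b n)\<^sup>2 * c (\<iota> n)) * (\<eta> (\<iota> n) x)\<^sup>2"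
        by (simp only: mult_ac)
      then show ?thesis unfolding b2 by (simp add: power_divide)
    qed
    moreover have "(2 ^ n * c (\<iota> n)) * (2 ^ n * (\<phi> x)\<^sup>2) = 4 ^ n * c (\<iota> n) * (\<phi> x)\<^sup>2"
      using power_mult_distrib[of "2::real" 2 n] by simp
    ultimately show "(\<eta> (\<iota> n) x)\<^sup>2 \<le> 4 ^ n * c (\<iota> n) * (\<phi> x)\<^sup>2" by simp
  qed
  with bad show False by blast
qed

definition tent :: "'a \<Rightarrow> real \<Rightarrow> 'a \<Rightarrow> real" where
  "tent a r x = max 0 (1 - dist a x / r)"

lemma tent_borel [measurable]: "tent a r \<in> borel_measurable borel"
  unfolding tent_def by measurable

text \<open>
  The tent is Lipschitz with constant \<open>1 / r\<close>, takes values in \<open>[0, 1]\<close>, and vanishes outside the ball.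
\<close>
lemma tent_diff_sq_le:
  assumes r: "r > 0"
  shows "(tent a r x - tent a r y)\<^sup>2
    \<le> (indicator (ball a r) x + indicator (ball a r) y) * (min ((norm (x - y))\<^sup>2) (r\<^sup>2) / r\<^sup>2)"
proof (cases "x \<in> ball a r \<or> y \<in> ball a r")
  case True
  have t: "0 \<le> tent a r z" "tent a r z \<le> 1" for z using r by (auto simp: tent_def)
  have "\<bar>tent a r x - tent a r y\<bar> \<le> \<bar>dist a y / r - dist a x / r\<bar>" by (auto simp: tent_def)
  also have "\<dots> = \<bar>dist a y - dist a x\<bar> / r" using r by (simp flip: diff_divide_distrib)
  also have "\<dots> \<le> norm (x - y) / r"
    using r dist_triangle[of a y x] dist_triangle[of a x y]
    by (intro divide_right_mono) (auto simp: dist_norm abs_le_iff norm_minus_commute)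
  finally have "(tent a r x - tent a r y)\<^sup>2 \<le> (norm (x - y) / r)\<^sup>2"
    using abs_le_square_iff[of "tent a r x - tent a r y" "norm (x - y) / r"] r by simp
  moreover have "(tent a r x - tent a r y)\<^sup>2 \<le> 1"
    using t[of x] t[of y] by (simp add: abs_square_le_1 abs_le_iff)
  ultimately have "(tent a r x - tent a r y)\<^sup>2 \<le> min ((norm (x - y))\<^sup>2) (r\<^sup>2) / r\<^sup>2"
    using r by (auto simp: min_def power_divide)
  also have "\<dots> \<le> (indicator (ball a r) x + indicator (ball a r) y) * (min ((norm (x - y))\<^sup>2) (r\<^sup>2) / r\<^sup>2)"
    using True mult_right_mono[of 1 "indicator (ball a r) x + indicator (ball a r) y"
        "min ((norm (x - y))\<^sup>2) (r\<^sup>2) / r\<^sup>2"] by (auto simp: indicator_def)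
  finally show ?thesis .
next
  case False
  then show ?thesis using r by (auto simp: tent_def)
qed

text \<open>
  Integrating the preceding estimate against \<open>k (x - y)\<close>, each of its two terms factors by translation
  invariance into the volume of the ball and the moment.
\<close>
lemma energy_tent_le:
  assumes r: "r > 0"
  shows "energy (tent a r) \<le> ennreal (2 * unit_ball_vol (real DIM('a)) * r ^ DIM('a) * moment r / r\<^sup>2)"
proof -
  define g where "g z = ennreal (min ((norm z)\<^sup>2) (r\<^sup>2) * k z)" for z :: 'a
  have [measurable]: "g \<in> borel_measurable borel" unfolding g_def by measurable
  have gm: "integral\<^sup>N lborel g = ennreal (moment r)" unfolding g_def by (rule nn_integral_moment)
  let ?B = "\<lambda>x. ennreal (indicator (ball a r) x / r\<^sup>2)"
  have [measurable]: "ball a r \<in> sets borel" by simp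
  have B: "(\<integral>\<^sup>+x. ?B x \<partial>lborel) = ennreal (unit_ball_vol (real DIM('a)) * r ^ DIM('a) / r\<^sup>2)"
  proof -
    have "(\<integral>\<^sup>+x. ?B x \<partial>lborel) = (\<integral>\<^sup>+x. ennreal (1/r\<^sup>2) * indicator (ball a r) x \<partial>lborel)"
      by (intro nn_integral_cong) (auto simp: indicator_def)
    also have "\<dots> = ennreal (1/r\<^sup>2) * ennreal (unit_ball_vol (real DIM('a)) * r ^ DIM('a))"
      using r by (simp add: nn_integral_cmult_indicator emeasure_ball)
    finally show ?thesis using r by (simp flip: ennreal_mult)
  qed
  have m1: "(\<lambda>z. ?B (fst z) * g (fst z - snd z)) \<in> borel_measurable (lborel \<Otimes>\<^sub>M lborel)"
    and m2: "(\<lambda>z. ?B (snd z) * g (fst z - snd z)) \<in> borel_measurable (lborel \<Otimes>\<^sub>M lborel)"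
    unfolding lborel_prod by (simp_all add: borel_prod[symmetric])
  have "energy (tent a r) \<le> (\<integral>\<^sup>+z. ?B (fst z) * g (fst z - snd z) + ?B (snd z) * g (fst z - snd z) \<partial>lborel)"
    unfolding energy_def
  proof (rule nn_integral_mono)
    fix z :: "'a \<times> 'a"
    have "(tent a r (fst z) - tent a r (snd z))\<^sup>2 * k (fst z - snd z)
      \<le> (indicator (ball a r) (fst z) + indicator (ball a r) (snd z))
        * (min ((norm (fst z - snd z))\<^sup>2) (r\<^sup>2) / r\<^sup>2) * k (fst z - snd z)"
      by (intro mult_right_mono tent_diff_sq_le r) simp
    also have "\<dots> = indicator (ball a r) (fst z) / r\<^sup>2 * (min ((norm (fst z - snd z))\<^sup>2) (r\<^sup>2) * k (fst z - snd z))
      + indicator (ball a r) (snd z) / r\<^sup>2 * (min ((norm (fst z - snd z))\<^sup>2) (r\<^sup>2) * k (fst z - snd z))"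
      by (simp add: algebra_simps add_divide_distrib)
    finally show "ennreal ((tent a r (fst z) - tent a r (snd z))\<^sup>2 * k (fst z - snd z))
      \<le> ?B (fst z) * g (fst z - snd z) + ?B (snd z) * g (fst z - snd z)"
      unfolding g_def by (simp add: ennreal_leI flip: ennreal_mult ennreal_plus)
  qed
  also have "\<dots> = (\<integral>\<^sup>+z. ?B (fst z) * g (fst z - snd z) \<partial>(lborel \<Otimes>\<^sub>M lborel))
      + (\<integral>\<^sup>+z. ?B (snd z) * g (fst z - snd z) \<partial>(lborel \<Otimes>\<^sub>M lborel))"
    unfolding lborel_prod[symmetric] by (rule nn_integral_add[OF m1 m2])
  also have "(\<integral>\<^sup>+z. ?B (fst z) * g (fst z - snd z) \<partial>(lborel \<Otimes>\<^sub>M lborel))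
      = (\<integral>\<^sup>+x. \<integral>\<^sup>+y. ?B x * g (x - y) \<partial>lborel \<partial>lborel)"
    using lborel.nn_integral_fst[OF m1] by simp
  also have "\<dots> = (\<integral>\<^sup>+x. ?B x \<partial>lborel) * ennreal (moment r)"
    by (simp add: nn_integral_cmult nn_integral_multc nn_integral_lborel_reflect gm)
  also have "(\<integral>\<^sup>+z. ?B (snd z) * g (fst z - snd z) \<partial>(lborel \<Otimes>\<^sub>M lborel))
      = (\<integral>\<^sup>+y. \<integral>\<^sup>+x. ?B y * g (x - y) \<partial>lborel \<partial>lborel)"
    using lborel_pair.nn_integral_snd[OF m2] by simp
  also have "\<dots> = (\<integral>\<^sup>+x. ?B x \<partial>lborel) * ennreal (moment r)"
    by (simp add: nn_integral_cmult nn_integral_multc nn_integral_lborel_translate gm)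
  also have "(\<integral>\<^sup>+x. ?B x \<partial>lborel) * ennreal (moment r) + (\<integral>\<^sup>+x. ?B x \<partial>lborel) * ennreal (moment r)
      = ennreal (2 * unit_ball_vol (real DIM('a)) * r ^ DIM('a) * moment r / r\<^sup>2)"
    unfolding B using moment_pos[OF r] r
    by (simp add: algebra_simps flip: ennreal_mult ennreal_plus)
  finally show ?thesis .
qed

lemma L2_tent_le:
  assumes r: "0 < r" "r \<le> 1"
  shows "(\<integral>\<^sup>+x. ennreal ((tent a r x)\<^sup>2) \<partial>lborel) \<le> ennreal (unit_ball_vol (real DIM('a)) / moment 1 * r ^ DIM('a) * moment r / r\<^sup>2)"
proof -
  have "(\<integral>\<^sup>+x. ennreal ((tent a r x)\<^sup>2) \<partial>lborel) \<le> (\<integral>\<^sup>+x. indicator (ball a r) x \<partial>lborel)"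
  proof (rule nn_integral_mono)
    fix x
    show "ennreal ((tent a r x)\<^sup>2) \<le> indicator (ball a r) x"
      using r by (auto simp: tent_def indicator_def power_le_one max_def)
  qed
  also have "\<dots> = ennreal (unit_ball_vol (real DIM('a)) * r ^ DIM('a))" using r by (simp add: emeasure_ball)
  also have "\<dots> \<le> ennreal (unit_ball_vol (real DIM('a)) / moment 1 * r ^ DIM('a) * moment r / r\<^sup>2)"
  proof (rule ennreal_leI)
    have "1 \<le> moment r / (r\<^sup>2 * moment 1)"
      using moment_ge_sq[of r] r moment_pos[of 1] by (simp add: le_divide_eq)
    then have "unit_ball_vol (real DIM('a)) * r ^ DIM('a) * 1 \<le> unit_ball_vol (real DIM('a)) * r ^ DIM('a) * (moment r / (r\<^sup>2 * moment 1))"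
      using r by (intro mult_left_mono) auto
    then show "unit_ball_vol (real DIM('a)) * r ^ DIM('a) \<le> unit_ball_vol (real DIM('a)) / moment 1 * r ^ DIM('a) * moment r / r\<^sup>2" by (simp add: field_simps)
  qed
  finally show ?thesis .
qed

text \<open>
  Uniform domination applied to tents: \<open>\<phi>\<close> must be large wherever a tent of small energy is at least 1/2.
  Countably many tents, with centres in a dense set and rational radii, suffice, so that the exceptional
  null set can be chosen once for all radii.
\<close>
lemma dominating_function_lower_bound:
  assumes K: "AE z in lborel. K z = k z" and \<Omega>: "open \<Omega>"
    and dom: "\<And>\<psi>. \<psi> \<in> X0 \<Omega> K \<Longrightarrow> (\<And>x. \<psi> x \<ge> 0) \<Longrightarrow>
      \<exists>R. AE x in lborel. x \<in> \<Omega> \<longrightarrow> \<psi> x \<le> R * \<phi> x"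
  obtains C where "C > 0"
    "AE x in lborel. \<forall>r\<in>\<rat>. 0 < r \<longrightarrow> r \<le> 1 \<longrightarrow> ball x (2 * r) \<subseteq> \<Omega> \<longrightarrow>
      r\<^sup>2 \<le> C * r ^ DIM('a) * moment r * (\<phi> x)\<^sup>2"
proof -
  obtain D :: "'a set" where D: "countable D" "\<And>U. open U \<Longrightarrow> U \<noteq> {} \<Longrightarrow> \<exists>d\<in>D. d \<in> U"
    by (rule countable_dense_setE) blast
  define I where "I = {(a, r). a \<in> D \<and> r \<in> \<rat> \<and> 0 < r \<and> r \<le> 1 \<and> ball a r \<subseteq> \<Omega>}"
  define M where "M = 2 * unit_ball_vol (real DIM('a)) + unit_ball_vol (real DIM('a)) / moment 1"
  have M: "M > 0" "2 * unit_ball_vol (real DIM('a)) \<le> M" "unit_ball_vol (real DIM('a)) / moment 1 \<le> M"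
    using moment_pos[of 1] by (auto simp: M_def intro!: add_pos_pos divide_pos_pos less_imp_le)
  define c where "c = (\<lambda>(a::'a, r). M * (r ^ DIM('a) * moment r / r\<^sup>2))"
  have "\<exists>C>0. \<forall>i\<in>I. AE x in lborel. x \<in> \<Omega> \<longrightarrow> (tent (fst i) (snd i) x)\<^sup>2 \<le> C * c i * (\<phi> x)\<^sup>2"
  proof (rule uniform_domination[OF K \<Omega>])
    fix i assume "i \<in> I"
    then obtain a r where i: "i = (a, r)" "0 < r" "r \<le> 1" "ball a r \<subseteq> \<Omega>" by (auto simp: I_def)
    have q: "0 \<le> r ^ DIM('a) * moment r / r\<^sup>2" using i moment_pos[of r] by simp
    show "tent (fst i) (snd i) \<in> borel_measurable borel" by (simp add: i)
    show "0 \<le> tent (fst i) (snd i) x" for x by (simp add: i tent_def)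
    show "tent (fst i) (snd i) x = 0" if "x \<notin> \<Omega>" for x
    proof -
      have "x \<notin> ball a r" using i that by auto
      then show ?thesis using i by (simp add: tent_def)
    qed
    show "c i > 0" using i M moment_pos[of r] by (simp add: c_def)
    show "(\<integral>\<^sup>+x. ennreal ((tent (fst i) (snd i) x)\<^sup>2) \<partial>lborel) \<le> ennreal (c i)"
      using order_trans[OF L2_tent_le[OF i(2,3), of a] ennreal_leI] mult_right_mono[OF M(3) q]
      by (simp add: i c_def mult.assoc)
    show "energy (tent (fst i) (snd i)) \<le> ennreal (c i)"
      using order_trans[OF energy_tent_le[OF i(2), of a] ennreal_leI] mult_right_mono[OF M(2) q]
      by (simp add: i c_def mult.assoc)
  qed (rule dom)
  then obtain C where C: "C > 0"
    "\<And>i. i \<in> I \<Longrightarrow> AE x in lborel. x \<in> \<Omega> \<longrightarrow> (tent (fst i) (snd i) x)\<^sup>2 \<le> C * c i * (\<phi> x)\<^sup>2"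
    by blast
  have "countable I"
    by (rule countable_subset[of _ "D \<times> \<rat>"]) (auto simp: I_def D(1) countable_rat)
  then have ae: "AE x in lborel. \<forall>i\<in>I. x \<in> \<Omega> \<longrightarrow> (tent (fst i) (snd i) x)\<^sup>2 \<le> C * c i * (\<phi> x)\<^sup>2"
    by (subst AE_ball_countable) (use C(2) in auto)
  show thesis
  proof
    show "4 * C * M > 0" using C M by simp
    show "AE x in lborel. \<forall>r\<in>\<rat>. 0 < r \<longrightarrow> r \<le> 1 \<longrightarrow> ball x (2 * r) \<subseteq> \<Omega> \<longrightarrow>
      r\<^sup>2 \<le> 4 * C * M * r ^ DIM('a) * moment r * (\<phi> x)\<^sup>2"
      using ae
    proof (eventually_elim, intro ballI impI)
      fix x r assume x: "\<forall>i\<in>I. x \<in> \<Omega> \<longrightarrow> (tent (fst i) (snd i) x)\<^sup>2 \<le> C * c i * (\<phi> x)\<^sup>2"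
        and r: "r \<in> \<rat>" "0 < r" "r \<le> 1" and sub: "ball x (2 * r) \<subseteq> \<Omega>"
      obtain a where a: "a \<in> D" "dist x a < r / 2" using D(2)[of "ball x (r/2)"] r by auto
      have "ball a r \<subseteq> ball x (2 * r)"
      proof
        fix y assume "y \<in> ball a r"
        then show "y \<in> ball x (2 * r)" using a r(2) dist_triangle[of x y a] by simp
      qed
      then have "(a, r) \<in> I" using a r sub by (auto simp: I_def)
      moreover have "x \<in> \<Omega>" using sub r by auto
      ultimately have "(tent a r x)\<^sup>2 \<le> C * c (a, r) * (\<phi> x)\<^sup>2" using x by force
      moreover have "dist a x / r \<le> 1/2" using a r by (simp add: dist_commute field_simps)
      then have "1/2 \<le> tent a r x" unfolding tent_def by linarith
      then have "(1/2)\<^sup>2 \<le> (tent a r x)\<^sup>2" by (intro power_mono) auto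
      ultimately have "(1/2)\<^sup>2 \<le> C * c (a, r) * (\<phi> x)\<^sup>2" by linarith
      then show "r\<^sup>2 \<le> 4 * C * M * r ^ DIM('a) * moment r * (\<phi> x)\<^sup>2"
        using r by (simp add: c_def power2_eq_square field_simps)
    qed
  qed
qed

end

section \<open>Contradiction from the pointwise lower bound\<close>

context symmetric_kernel
begin

text \<open>
  In dimension at least 2 points have capacity zero: tents of radius \<open>r\<close> have energy at most a constant
  times \<open>moment r\<close>, which tends to 0 with \<open>r\<close>. So the bound would force \<open>f\<close> to be infinite at almost
  every point of \<open>\<Omega>\<close>.
\<close>
lemma no_pointwise_bound_dim_ge_2:
  fixes f :: "'a \<Rightarrow> real"
  assumes \<Omega>: "open \<Omega>" "\<Omega> \<noteq> {}" and dim: "DIM('a) \<ge> 2" and C: "C > 0"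
    and bound: "AE x in lborel. \<forall>r\<in>\<rat>. 0 < r \<longrightarrow> r \<le> 1 \<longrightarrow> ball x (2 * r) \<subseteq> \<Omega> \<longrightarrow>
      r\<^sup>2 \<le> C * r ^ DIM('a) * moment r * (f x)\<^sup>2"
  shows False
proof -
  let ?P = "\<lambda>x. \<forall>r\<in>\<rat>. 0 < r \<longrightarrow> r \<le> 1 \<longrightarrow> ball x (2 * r) \<subseteq> \<Omega> \<longrightarrow>
      r\<^sup>2 \<le> C * r ^ DIM('a) * moment r * (f x)\<^sup>2"
  obtain x where x: "x \<in> \<Omega>" "?P x"
  proof (rule ccontr)
    assume "\<not> thesis"
    then have "\<And>x. x \<in> \<Omega> \<Longrightarrow> \<not> ?P x" using that by blast
    then have "AE x in lborel. x \<notin> \<Omega>" using bound by (auto elim!: eventually_mono)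
    then have "\<Omega> \<in> null_sets lborel" using \<Omega>(1) by (subst (asm) AE_iff_null_sets[symmetric]) auto
    then show False using \<Omega> open_not_negligible[OF \<Omega>] by (simp add: negligible_iff_null_sets null_sets_completionI)
  qed
  obtain \<rho> where \<rho>: "\<rho> > 0" "ball x \<rho> \<subseteq> \<Omega>" using \<Omega>(1) x(1) open_contains_ball by blast
  have "\<forall>\<^sub>F i in sequentially. 1 \<le> C * moment (1 / real (Suc i)) * (f x)\<^sup>2"
  proof -
    have "\<forall>\<^sub>F i in sequentially. 1 / real (Suc i) < \<rho> / 2"
      using order_tendstoD(2)[OF LIMSEQ_Suc[OF lim_1_over_n], of "\<rho>/2"] \<rho>(1) by simp
    then show ?thesis
    proof eventually_elim
      case (elim i)
      define r where "r = 1 / real (Suc i)"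
      have r: "r \<in> \<rat>" "0 < r" "r \<le> 1" by (auto simp: r_def)
      have "ball x (2 * r) \<subseteq> ball x \<rho>" using elim by (intro subset_ball) (simp add: r_def)
      then have "r\<^sup>2 \<le> C * r ^ DIM('a) * moment r * (f x)\<^sup>2" using x(2) r \<rho>(2) by blast
      also have "\<dots> \<le> C * r\<^sup>2 * moment r * (f x)\<^sup>2"
        using C r dim moment_pos[of r]
        by (intro mult_right_mono mult_left_mono power_decreasing) auto
      finally have "r\<^sup>2 * 1 \<le> r\<^sup>2 * (C * moment r * (f x)\<^sup>2)" by (simp only: mult_ac mult_1_right)
      then show ?case using r(2) unfolding r_def[symmetric] by (simp only: mult_le_cancel_left_pos zero_less_power)
    qed
  qed
  moreover have "(\<lambda>i. C * moment (1 / real (Suc i)) * (f x)\<^sup>2) \<longlonglongrightarrow> C * 0 * (f x)\<^sup>2"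
    by (intro tendsto_intros moment_tendsto_0)
  ultimately have "1 \<le> C * 0 * (f x)\<^sup>2" by (intro tendsto_lowerbound) auto
  then show False by simp
qed

text \<open>
  The assumption on \<open>e\<close> says that the space is one-dimensional. Each half-line carries half of the moment,
  as the kernel is even.
\<close>
lemma half_moment:
  fixes e :: 'a
  assumes e: "\<And>w. w \<bullet> e = 0 \<Longrightarrow> w = 0"
  shows "ennreal (moment b) \<le> 2 * (\<integral>\<^sup>+w. indicator {w. w \<bullet> e > 0} w * ennreal (min ((norm w)\<^sup>2) (b\<^sup>2) * k w) \<partial>lborel)"
proof -
  define g where "g w = ennreal (min ((norm w)\<^sup>2) (b\<^sup>2) * k w)" for w :: 'a
  have [measurable]: "g \<in> borel_measurable borel" unfolding g_def by measurable
  define h where "h w = indicator {w. w \<bullet> e > 0} w * g w" for w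
  have [measurable]: "h \<in> borel_measurable borel" unfolding h_def by measurable
  have "ennreal (moment b) = (\<integral>\<^sup>+w. g w \<partial>lborel)" unfolding g_def by (rule nn_integral_moment[symmetric])
  also have "\<dots> \<le> (\<integral>\<^sup>+w. h w + h (0 - w) \<partial>lborel)"
  proof (rule nn_integral_mono)
    fix w :: 'a
    consider "w \<bullet> e > 0" | "w \<bullet> e < 0" | "w = 0" using e[of w] by linarith
    then show "g w \<le> h w + h (0 - w)"
      by cases (auto simp: h_def g_def k_even)
  qed
  also have "\<dots> = (\<integral>\<^sup>+w. h w \<partial>lborel) + (\<integral>\<^sup>+w. h (0 - w) \<partial>lborel)"
    by (rule nn_integral_add) measurable
  also have "\<dots> = 2 * (\<integral>\<^sup>+w. h w \<partial>lborel)"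
    by (subst nn_integral_lborel_reflect) (auto simp: mult_2)
  finally show ?thesis by (simp add: h_def g_def)
qed

text \<open>
  On the line, write \<open>d x = x \<bullet> e - m\<close> and \<open>\<kappa>(t)\<close> for the mass of \<open>k\<close> on \<open>(t, \<infinity>)\<close>. The right-hand side is
  \<open>\<integral>\<^sub>0\<^sup>b t \<kappa>(t) dt\<close>, and by Fubini this is \<open>\<integral> k(w) (\<integral> t dt) dw\<close> over \<open>w > 0\<close> and \<open>0 < t < min b w\<close>. The
  inner integral is of order \<open>(min b w)\<^sup>2\<close>, so the double integral is comparable to \<open>moment b\<close>; in other
  words, \<open>4 t \<kappa>(t)\<close> is the derivative of the moment.
\<close>
lemma hardy_weight_lower_bound:
  fixes e :: 'a
  assumes dim: "DIM('a) = 1" and e: "e \<in> Basis" and b: "b > 0"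
  shows "ennreal (unit_ball_vol (real DIM('a)) / 16 * moment b)
    \<le> (\<integral>\<^sup>+z. ennreal (indicator {z. 0 < fst z \<bullet> e - m \<and> fst z \<bullet> e - m < b \<and> snd z \<bullet> e - m \<le> 0} z
        * ((fst z \<bullet> e - m) * k (fst z - snd z))) \<partial>(lborel :: ('a \<times> 'a) measure))"
proof -
  let ?\<omega> = "unit_ball_vol (real DIM('a))"
  let ?d = "\<lambda>x::'a. x \<bullet> e - m"
  have Basis: "Basis = {e}" using dim e by (metis card_1_singletonE singletonD)
  have norm: "norm w = \<bar>w \<bullet> e\<bar>" for w :: 'a
    using norm_le_l1[of w] Basis_le_norm[OF e, of w] by (simp add: Basis)
  have e1: "e \<bullet> e = 1" using e by (simp add: inner_same_Basis)
  let ?g = "\<lambda>x w. ennreal (indicator {x. 0 < ?d x \<and> ?d x < b \<and> ?d x \<le> w \<bullet> e} x * (?d x * k w))"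
  have inner: "ennreal (?\<omega> / 8 * (min ((norm w)\<^sup>2) (b\<^sup>2) * k w)) \<le> (\<integral>\<^sup>+x. ?g x w \<partial>lborel)"
    if w: "w \<bullet> e > 0" for w
  proof -
    define \<mu> where "\<mu> = min b (w \<bullet> e)"
    have \<mu>: "\<mu> > 0" "\<mu> \<le> b" "\<mu> \<le> w \<bullet> e" using b w by (auto simp: \<mu>_def)
    have \<mu>2: "\<mu>\<^sup>2 = min ((norm w)\<^sup>2) (b\<^sup>2)"
      using b w by (auto simp: \<mu>_def norm min_def power2_le_iff_abs_le abs_le_square_iff[symmetric])
    \<comment> \<open>The ball of radius \<open>\<mu> / 4\<close> about \<open>c\<close> is the set \<open>\<mu> / 2 < d < \<mu>\<close>.\<close>
    define c where "c = (m + 3 * \<mu> / 4) *\<^sub>R e"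
    have "ennreal (?\<omega> / 8 * (min ((norm w)\<^sup>2) (b\<^sup>2) * k w)) = ennreal (\<mu> / 2 * k w) * ennreal (?\<omega> * (\<mu>/4) ^ DIM('a))"
      unfolding \<mu>2[symmetric]
      using \<mu>(1) by (simp add: dim power2_eq_square algebra_simps flip: ennreal_mult)
    also have "\<dots> = (\<integral>\<^sup>+x. ennreal (\<mu> / 2 * k w) * indicator (ball c (\<mu>/4)) x \<partial>lborel)"
      using \<mu>(1) by (simp add: nn_integral_cmult_indicator emeasure_ball)
    also have "\<dots> \<le> (\<integral>\<^sup>+x. ?g x w \<partial>lborel)"
    proof (rule nn_integral_mono)
      fix x
      show "ennreal (\<mu> / 2 * k w) * indicator (ball c (\<mu>/4)) x \<le> ?g x w"
      proof (cases "x \<in> ball c (\<mu>/4)")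
        case True
        then have "\<bar>(c - x) \<bullet> e\<bar> < \<mu> / 4" by (simp add: dist_norm norm)
        moreover have "(c - x) \<bullet> e = 3 * \<mu> / 4 - ?d x" by (simp add: c_def inner_diff_left e1)
        ultimately have "\<mu> / 2 \<le> ?d x" "?d x < \<mu>" by linarith+
        then have "\<mu> / 2 * k w \<le> ?d x * k w" and "0 < ?d x" "?d x < b" "?d x \<le> w \<bullet> e"
          using \<mu> by (auto simp only: k_nonneg intro!: mult_right_mono)
        then show ?thesis using True by (auto intro!: ennreal_leI)
      qed simp
    qed
    finally show ?thesis .
  qed
  have m1: "(\<lambda>z. ennreal (indicator {z. 0 < ?d (fst z) \<and> ?d (fst z) < b \<and> ?d (snd z) \<le> 0} z
        * (?d (fst z) * k (fst z - snd z)))) \<in> borel_measurable (lborel \<Otimes>\<^sub>M lborel)"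
    unfolding lborel_prod by (simp add: borel_prod[symmetric])
  have m2: "(\<lambda>z. ?g (fst z) (snd z)) \<in> borel_measurable (lborel \<Otimes>\<^sub>M lborel)"
    unfolding lborel_prod indicator_def by (simp add: borel_prod[symmetric])
  have "ennreal (?\<omega> / 16 * moment b) = ennreal (?\<omega> / 16) * ennreal (moment b)"
    using moment_pos[OF b] by (intro ennreal_mult) auto
  also have "\<dots> \<le> ennreal (?\<omega> / 16) *
      (2 * (\<integral>\<^sup>+w. indicator {w. w \<bullet> e > 0} w * ennreal (min ((norm w)\<^sup>2) (b\<^sup>2) * k w) \<partial>lborel))"
  proof (intro mult_left_mono half_moment)
    show "w = 0" if "w \<bullet> e = 0" for w using norm[of w] that by simp
  qed simp
  also have "\<dots> = ennreal (?\<omega> / 8) *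
      (\<integral>\<^sup>+w. indicator {w. w \<bullet> e > 0} w * ennreal (min ((norm w)\<^sup>2) (b\<^sup>2) * k w) \<partial>lborel)"
  proof -
    have "ennreal (?\<omega> / 16) * 2 = ennreal (?\<omega> / 8)"
      using ennreal_mult[of "?\<omega> / 16" 2] by simp
    then show ?thesis by (simp only: mult.assoc[symmetric])
  qed
  also have "\<dots> = (\<integral>\<^sup>+w. ennreal (?\<omega> / 8) *
      (indicator {w. w \<bullet> e > 0} w * ennreal (min ((norm w)\<^sup>2) (b\<^sup>2) * k w)) \<partial>lborel)"
    by (rule nn_integral_cmult[symmetric]) measurable
  also have "\<dots> \<le> (\<integral>\<^sup>+w. \<integral>\<^sup>+x. ?g x w \<partial>lborel \<partial>lborel)"
  proof (rule nn_integral_mono)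
    fix w
    show "ennreal (?\<omega> / 8) * (indicator {w. w \<bullet> e > 0} w * ennreal (min ((norm w)\<^sup>2) (b\<^sup>2) * k w))
        \<le> (\<integral>\<^sup>+x. ?g x w \<partial>lborel)"
      using inner[of w] by (cases "w \<bullet> e > 0") (auto simp flip: ennreal_mult)
  qed
  also have "\<dots> = (\<integral>\<^sup>+x. \<integral>\<^sup>+w. ?g x w \<partial>lborel \<partial>lborel)"
    using lborel_pair.nn_integral_snd[OF m2] lborel.nn_integral_fst[OF m2] by simp
  also have "\<dots> = (\<integral>\<^sup>+x. \<integral>\<^sup>+y. ?g x (x - y) \<partial>lborel \<partial>lborel)"
  proof (rule nn_integral_cong)
    fix x
    have [measurable]: "?g x \<in> borel_measurable borel" unfolding indicator_def by simp
    show "(\<integral>\<^sup>+w. ?g x w \<partial>lborel) = (\<integral>\<^sup>+y. ?g x (x - y) \<partial>lborel)"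
      by (rule nn_integral_lborel_reflect[symmetric]) measurable
  qed
  also have "\<dots> = (\<integral>\<^sup>+x. \<integral>\<^sup>+y. ennreal (indicator {z. 0 < ?d (fst z) \<and> ?d (fst z) < b \<and> ?d (snd z) \<le> 0} (x, y)
        * (?d x * k (x - y))) \<partial>lborel \<partial>lborel)"
    by (intro nn_integral_cong arg_cong[where f = ennreal]) (auto simp: indicator_def inner_diff_left)
  also have "\<dots> = (\<integral>\<^sup>+z. ennreal (indicator {z. 0 < ?d (fst z) \<and> ?d (fst z) < b \<and> ?d (snd z) \<le> 0} z
        * (?d (fst z) * k (fst z - snd z))) \<partial>(lborel \<Otimes>\<^sub>M lborel))"
    using lborel.nn_integral_fst[OF m1] by simp
  finally show ?thesis unfolding lborel_prod .
qed

text \<open>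
  In dimension 1 points may have positive capacity, and the contradiction comes from the left end \<open>m\<close> of
  the interval \<open>\<Omega>\<close>. At distance \<open>d < b\<close> from \<open>m\<close>, a tent of radius comparable to \<open>d\<close> fits into \<open>\<Omega>\<close>, so the
  bound gives \<open>f\<^sup>2 \<ge> d / (4 C moment b)\<close>. The interaction of \<open>{0 < d < b}\<close> with the complement of \<open>\<Omega>\<close> then
  contributes at least a constant independent of \<open>b\<close> to the energy of \<open>f\<close>, by the preceding lemma. But
  these contributions tend to 0 with \<open>b\<close> because the energy is finite.
\<close>
lemma no_pointwise_bound_dim_1:
  fixes f :: "'a \<Rightarrow> real"
  assumes \<Omega>: "open \<Omega>" "connected \<Omega>" "\<Omega> \<noteq> {}" "bounded \<Omega>" and dim: "DIM('a) = 1" and C: "C > 0"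
    and f: "f \<in> borel_measurable borel" "\<And>x. x \<notin> \<Omega> \<Longrightarrow> f x = 0" "energy f < \<infinity>"
    and bound: "AE x in lborel. \<forall>r\<in>\<rat>. 0 < r \<longrightarrow> r \<le> 1 \<longrightarrow> ball x (2 * r) \<subseteq> \<Omega> \<longrightarrow>
      r\<^sup>2 \<le> C * r ^ DIM('a) * moment r * (f x)\<^sup>2"
  shows False
proof -
  note [measurable] = f(1)
  obtain e :: 'a where Basis: "Basis = {e}" using dim card_1_singletonE by metis
  have e: "e \<in> Basis" by (simp add: Basis)
  have e1: "e \<bullet> e = 1" using e by (simp add: inner_same_Basis)
  have norm: "norm w = \<bar>w \<bullet> e\<bar>" for w :: 'a
    using norm_le_l1[of w] Basis_le_norm[OF e, of w] by (simp add: Basis)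
  have eqI: "x = y" if "x \<bullet> e = y \<bullet> e" for x y :: 'a
    using that norm[of "x - y"] by (simp add: inner_diff_left)
  define m where "m = Inf ((\<lambda>x. x \<bullet> e) ` \<Omega>)"
  let ?d = "\<lambda>x::'a. x \<bullet> e - m"
  have bdd: "bdd_below ((\<lambda>x. x \<bullet> e) ` \<Omega>)"
    using \<Omega>(4) by (intro bounded_imp_bdd_below bounded_linear_image bounded_linear_inner_left)
  have d_pos: "?d x > 0" if x: "x \<in> \<Omega>" for x
  proof -
    obtain \<rho> where \<rho>: "\<rho> > 0" "cball x \<rho> \<subseteq> \<Omega>" using \<Omega>(1) x open_contains_cball by blast
    then have "x - \<rho> *\<^sub>R e \<in> \<Omega>" by (auto simp: subset_iff dist_norm norm e1)
    then have "m \<le> (x - \<rho> *\<^sub>R e) \<bullet> e" unfolding m_def by (intro cInf_lower imageI bdd)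
    then show ?thesis using \<rho>(1) by (simp add: inner_diff_left e1)
  qed
  obtain p where p: "p \<in> \<Omega>" using \<Omega>(3) by blast
  have near: "x \<in> \<Omega>" if x: "0 < ?d x" "?d x < ?d p" for x
  proof -
    have "Inf ((\<lambda>x. x \<bullet> e) ` \<Omega>) < x \<bullet> e" using x(1) by (simp add: m_def)
    then obtain q where q: "q \<in> \<Omega>" "q \<bullet> e < x \<bullet> e"
      using cInf_less_iff[OF _ bdd] \<Omega>(3) by auto
    then obtain y where "y \<in> \<Omega>" "y \<bullet> e = x \<bullet> e"
      using connected_ivt_hyperplane[OF \<Omega>(2) q(1) p, of e "x \<bullet> e"] x(2)
      by (auto simp: inner_commute)
    then show ?thesis using eqI by metis
  qed
  define b0 where "b0 = min 1 (?d p / 2)"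
  have b0: "b0 > 0" "b0 \<le> 1" "2 * b0 \<le> ?d p" using d_pos[OF p] by (auto simp: b0_def min_def)
  have growth: "AE x in lborel. 0 < ?d x \<longrightarrow> ?d x < b \<longrightarrow> ?d x \<le> 4 * C * moment b * (f x)\<^sup>2"
    if b: "0 < b" "b \<le> b0" for b
    using bound
  proof (eventually_elim, intro impI)
    fix x assume x: "\<forall>r\<in>\<rat>. 0 < r \<longrightarrow> r \<le> 1 \<longrightarrow> ball x (2 * r) \<subseteq> \<Omega> \<longrightarrow>
      r\<^sup>2 \<le> C * r ^ DIM('a) * moment r * (f x)\<^sup>2" and d: "0 < ?d x" "?d x < b"
    obtain r where r: "r \<in> \<rat>" "?d x / 4 < r" "r < ?d x / 2"
      using Rats_dense_in_real[of "?d x / 4" "?d x / 2"] d by auto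
    have r1: "0 < r" "r \<le> b" using r d b by auto
    then have r2: "r \<le> 1" using b b0 by simp
    have "ball x (2 * r) \<subseteq> \<Omega>"
    proof
      fix y assume "y \<in> ball x (2 * r)"
      then have "\<bar>?d x - ?d y\<bar> < 2 * r" by (simp add: dist_norm norm inner_diff_left)
      then have "0 < ?d y" "?d y < ?d p" using r d b b0 by auto
      then show "y \<in> \<Omega>" by (rule near)
    qed
    then have "r\<^sup>2 \<le> C * r ^ DIM('a) * moment r * (f x)\<^sup>2" using x r(1) r1 r2 by blast
    then have "r * r \<le> r * (C * moment r * (f x)\<^sup>2)" by (simp add: dim power2_eq_square mult_ac)
    then have "r \<le> C * moment r * (f x)\<^sup>2" using r1 by simp
    also have "\<dots> \<le> C * moment b * (f x)\<^sup>2"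
      using C r1 by (intro mult_right_mono mult_left_mono moment_mono) auto
    finally show "?d x \<le> 4 * C * moment b * (f x)\<^sup>2" using r(2) by simp
  qed
  let ?S = "\<lambda>b. {z::'a\<times>'a. 0 < ?d (fst z) \<and> ?d (fst z) < b \<and> ?d (snd z) \<le> 0}"
  define F where "F z = (f (fst z) - f (snd z))\<^sup>2 * k (fst z - snd z)" for z
  have F0: "F z \<ge> 0" for z by (simp add: F_def)
  have [measurable]: "F \<in> borel_measurable borel" unfolding F_def by (simp add: borel_prod[symmetric])
  have [measurable]: "?S b \<in> sets borel" for b
  proof -
    have "{z \<in> space (borel \<Otimes>\<^sub>M borel). z \<in> ?S b} \<in> sets (borel \<Otimes>\<^sub>M borel)"
      unfolding mem_Collect_eq by measurable
    then show ?thesis unfolding borel_prod by simp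
  qed
  define I where "I b = (\<integral>\<^sup>+z. ennreal (indicator (?S b) z * F z) \<partial>lborel)" for b
  let ?\<omega> = "unit_ball_vol (real DIM('a))"
  have lower: "ennreal (?\<omega> / (64 * C)) \<le> I b" if b: "0 < b" "b \<le> b0" for b
  proof -
    have mb: "moment b > 0" by (rule moment_pos[OF b(1)])
    define q where "q = 1 / (4 * C * moment b)"
    have q: "q > 0" using C mb by (simp add: q_def)
    have "ennreal (?\<omega> / (64 * C)) = ennreal q * ennreal (?\<omega> / 16 * moment b)"
      using C mb by (simp add: q_def flip: ennreal_mult)
    also have "\<dots> \<le> ennreal q * (\<integral>\<^sup>+z. ennreal (indicator (?S b) z * (?d (fst z) * k (fst z - snd z))) \<partial>lborel)"
      by (intro mult_left_mono hardy_weight_lower_bound dim e b) simp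
    also have "\<dots> = (\<integral>\<^sup>+z. ennreal q * ennreal (indicator (?S b) z * (?d (fst z) * k (fst z - snd z))) \<partial>lborel)"
      by (rule nn_integral_cmult[symmetric]) (simp add: borel_prod[symmetric])
    also have "\<dots> \<le> I b"
      unfolding I_def
    proof (rule nn_integral_mono_AE)
      show "AE z in lborel. ennreal q * ennreal (indicator (?S b) z * (?d (fst z) * k (fst z - snd z)))
          \<le> ennreal (indicator (?S b) z * F z)"
        using AE_lborel_fst[OF growth[OF b]]
      proof eventually_elim
        case (elim z)
        show ?case
        proof (cases "z \<in> ?S b")
          case True
          then have "snd z \<notin> \<Omega>" using d_pos[of "snd z"] by auto
          then have F: "F z = (f (fst z))\<^sup>2 * k (fst z - snd z)" by (simp add: F_def f)
          have "?d (fst z) \<le> 4 * C * moment b * (f (fst z))\<^sup>2" using elim True by simp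
          then have "q * ?d (fst z) \<le> (f (fst z))\<^sup>2"
            using C mb by (simp add: q_def divide_le_eq mult_ac)
          then have "q * ?d (fst z) * k (fst z - snd z) \<le> F z"
            unfolding F by (intro mult_right_mono) auto
          then show ?thesis using True q
            by (simp add: mult.assoc ennreal_leI flip: ennreal_mult)
        qed simp
      qed
    qed
    finally show ?thesis .
  qed
  have "(\<lambda>i. I (1 / real (Suc i))) \<longlonglongrightarrow> (\<integral>\<^sup>+z. 0 \<partial>(lborel :: ('a \<times> 'a) measure))"
    unfolding I_def
  proof (rule nn_integral_dominated_convergence[where w = "\<lambda>z. ennreal (F z)"])
    show "(\<integral>\<^sup>+z. ennreal (F z) \<partial>lborel) < \<infinity>" using f(3) by (simp add: energy_def F_def)
    show "AE z in lborel. ennreal (indicator (?S (1 / real (Suc i))) z * F z) \<le> ennreal (F z)" for i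
      using F0 by (auto simp: indicator_def)
    show "AE z in lborel. (\<lambda>i. ennreal (indicator (?S (1 / real (Suc i))) z * F z)) \<longlonglongrightarrow> 0"
    proof (rule AE_I2)
      fix z :: "'a \<times> 'a"
      have "\<forall>\<^sub>F i in sequentially. z \<notin> ?S (1 / real (Suc i))"
      proof (cases "?d (fst z) > 0")
        case True
        then have "\<forall>\<^sub>F i in sequentially. 1 / real (Suc i) < ?d (fst z)"
          by (intro order_tendstoD(2)[OF LIMSEQ_Suc[OF lim_1_over_n]])
        then show ?thesis by eventually_elim auto
      qed simp
      then have "\<forall>\<^sub>F i in sequentially. ennreal (indicator (?S (1 / real (Suc i))) z * F z) = 0"
        by eventually_elim simp
      then show "(\<lambda>i. ennreal (indicator (?S (1 / real (Suc i))) z * F z)) \<longlonglongrightarrow> 0"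
        by (rule tendsto_eventually)
    qed
  qed measurable
  moreover have "\<forall>\<^sub>F i in sequentially. ennreal (?\<omega> / (64 * C)) \<le> I (1 / real (Suc i))"
  proof -
    have "\<forall>\<^sub>F i in sequentially. 1 / real (Suc i) < b0"
      using b0(1) by (intro order_tendstoD(2)[OF LIMSEQ_Suc[OF lim_1_over_n]])
    then show ?thesis by eventually_elim (intro lower, auto)
  qed
  ultimately have "ennreal (?\<omega> / (64 * C)) \<le> 0" by (intro tendsto_lowerbound) auto
  moreover have "?\<omega> / (64 * C) > 0" using C by (intro divide_pos_pos) auto
  ultimately show False by (simp only: le_zero_eq ennreal_eq_0_iff)
qed

end

section \<open>The limit of the minimax levels\<close>

theorem theorem4p6:
  fixes s :: real and \<Omega> :: "'a::euclidean_space set" and K \<phi>\<^sub>1 :: "'a \<Rightarrow> real"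
  assumes "0 < s" "s < 1"
    and "bounded_lipschitz_domain \<Omega>"
    and "admissible_kernel s K"
    and "nonneg_minimizer \<Omega> K \<phi>\<^sub>1"
    and "real DIM('a) \<ge> 2 * s"
  shows "((\<lambda>p. minimax_level \<Omega> K \<phi>\<^sub>1 p) \<longlongrightarrow> lambda1 \<Omega> K) at_top"
proof -
  have \<Omega>: "open \<Omega>" "connected \<Omega>" "\<Omega> \<noteq> {}" "bounded \<Omega>"
    using assms(3) by (auto simp: bounded_lipschitz_domain_def)
  have pos: "K z > 0" if "z \<noteq> 0" for z
    using assms(4) that unfolding admissible_kernel_def by blast
  have \<phi>\<^sub>1: "\<phi>\<^sub>1 \<in> X0 \<Omega> K" "AE x in lebesgue. \<phi>\<^sub>1 x \<ge> 0"
    using assms(5) by (auto simp: nonneg_minimizer_def unit_sphere_def)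
  obtain k where "symmetric_kernel k" and K: "AE z in lborel. K z = k z"
    using admissible_kernel_imp_symmetric_kernel[OF assms(4)] .
  interpret symmetric_kernel k by fact
  obtain f where f: "f \<in> borel_measurable borel" "AE x in lborel. \<phi>\<^sub>1 x = f x" "\<And>x. f x \<ge> 0"
    "\<And>x. x \<notin> \<Omega> \<Longrightarrow> f x = 0" "energy f < \<infinity>"
    using X0_borel_version[OF K \<Omega>(1) \<phi>\<^sub>1] by metis
  obtain \<psi> where \<psi>: "\<psi> \<in> X0 \<Omega> K" "\<And>x. \<psi> x \<ge> 0"
    and nd: "\<And>r. \<not> (AE x in lborel. x \<in> \<Omega> \<longrightarrow> \<psi> x \<le> r * f x)"
  proof (rule ccontr)
    assume "\<not> thesis"
    then have "\<exists>r. AE x in lborel. x \<in> \<Omega> \<longrightarrow> \<psi> x \<le> r * f x"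
      if "\<psi> \<in> X0 \<Omega> K" "\<And>x. \<psi> x \<ge> 0" for \<psi>
      using that \<open>\<And>\<psi>. \<lbrakk>\<psi> \<in> X0 \<Omega> K; \<And>x. \<psi> x \<ge> 0; \<And>r. \<not> (AE x in lborel. x \<in> \<Omega> \<longrightarrow> \<psi> x \<le> r * f x)\<rbrakk> \<Longrightarrow> thesis\<close>
      by blast
    then obtain C where C: "C > 0" "AE x in lborel. \<forall>r\<in>\<rat>. 0 < r \<longrightarrow> r \<le> 1 \<longrightarrow> ball x (2 * r) \<subseteq> \<Omega> \<longrightarrow>
        r\<^sup>2 \<le> C * r ^ DIM('a) * moment r * (f x)\<^sup>2"
      using dominating_function_lower_bound[OF K \<Omega>(1)] by blast
    have "DIM('a) = 1 \<or> DIM('a) \<ge> 2" using DIM_positive[where 'a = 'a] by linarith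
    then show False
      using no_pointwise_bound_dim_1[OF \<Omega> _ C(1) f(1) f(4) f(5) C(2)]
        no_pointwise_bound_dim_ge_2[OF \<Omega>(1,3) _ C] by blast
  qed
  show ?thesis
  proof (rule minimax_level_tendsto_lambda1[OF pos _ assms(5) \<psi>])
    show "\<Omega> \<in> sets lebesgue" using \<Omega>(1) by auto
    show "\<not> (AE x in lebesgue. x \<in> \<Omega> \<longrightarrow> \<psi> x \<le> r * \<phi>\<^sub>1 x)" for r
    proof
      assume "AE x in lebesgue. x \<in> \<Omega> \<longrightarrow> \<psi> x \<le> r * \<phi>\<^sub>1 x"
      then have "AE x in lborel. x \<in> \<Omega> \<longrightarrow> \<psi> x \<le> r * f x"
        unfolding AE_completion_iff using f(2) by eventually_elim simp
      with nd show False by blast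
    qed
  qed
qed

end
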